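(* Let $\ell\in\tfrac12+\mathbb{N}_0$ and let $\mathfrak{g}=\widehat{\mathfrak{cga}}_\ell(1,\mathbb{C})$ be the mass central extension of the complex conformal Galilei algebra with $d=1$. Then $H^2(\mathfrak{g},\mathfrak{g})=0$.
   Context: $\mathbb{N}_0=\{0,1,2,\dots\}$. For $\ell\in\frac12+\mathbb{N}_0$, the mass central extension $\widehat{\mathfrak{cga}}_\ell(1,\mathbb{C})$ is the complex Lie algebra of dimension $2\ell+5$ with basis $C,D,H$, $P_n$ ($0\le n\le 2\ell$), and a central element $M$, with non-trivial brackets \begin{align*} [D,H]&=2H,\quad [C,H]=D,\quad [D,C]=-2C,\\ [H,P_n]&=-nP_{n-1},\quad [D,P_n]=2(\ell-n)P_n,\quad [C,P_n]=(2\ell-n)P_{n+1},\\ [P_m,P_n]&=\delta_{m+n,2\ell}\,b_m\,M,\qquad b_m=(-1)^{m+\ell+\frac12}(2\ell-m)!\,m!. \end{align*} All other brackets of basis elements (not following by antisymmetry) vanish. $H^2(\mathfrak{g},\mathfrak{g})$ is the second Chevalley–Eilenberg cohomology space of $\mathfrak{g}$ with coefficients in the adjoint module. *)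

theory Defs
  imports Complex_Main "HOL-Library.Function_Algebras"
begin

section \<open>Lie algebras and modules\<close>

text \<open>The underlying space of a Lie algebra or module is a subspace of an ambient vector space,
  which is a whole type; this allows the dimension to depend on a parameter.\<close>

record ('k, 'v) lie_data =
  lspace :: "'v set"
  lscale :: "'k \<Rightarrow> 'v \<Rightarrow> 'v"
  lbracket :: "'v \<Rightarrow> 'v \<Rightarrow> 'v"

record ('k, 'v, 'w) lie_module_data =
  mspace :: "'w set"
  mscale :: "'k \<Rightarrow> 'w \<Rightarrow> 'w"
  mact :: "'v \<Rightarrow> 'w \<Rightarrow> 'w"

locale lie_algebra = vector_space "lscale g"
  for g :: "('k::field, 'v::ab_group_add) lie_data" +
  assumes lspace_subspace: "subspace (lspace g)"
    and bracket_closed: "\<lbrakk>x \<in> lspace g; y \<in> lspace g\<rbrakk> \<Longrightarrow> lbracket g x y \<in> lspace g"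
    and bracket_linear_left:
      "\<lbrakk>x \<in> lspace g; y \<in> lspace g; z \<in> lspace g\<rbrakk> \<Longrightarrow>
        lbracket g (lscale g a x + lscale g b y) z
          = lscale g a (lbracket g x z) + lscale g b (lbracket g y z)"
    and bracket_linear_right:
      "\<lbrakk>x \<in> lspace g; y \<in> lspace g; z \<in> lspace g\<rbrakk> \<Longrightarrow>
        lbracket g z (lscale g a x + lscale g b y)
          = lscale g a (lbracket g z x) + lscale g b (lbracket g z y)"
    and bracket_self: "x \<in> lspace g \<Longrightarrow> lbracket g x x = 0"
    and jacobi: "\<lbrakk>x \<in> lspace g; y \<in> lspace g; z \<in> lspace g\<rbrakk> \<Longrightarrow>
        lbracket g x (lbracket g y z) + lbracket g y (lbracket g z x)
          + lbracket g z (lbracket g x y) = 0"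

definition adjoint_module :: "('k, 'v) lie_data \<Rightarrow> ('k, 'v, 'v) lie_module_data" where
  "adjoint_module g = \<lparr>mspace = lspace g, mscale = lscale g, mact = lbracket g\<rparr>"


section \<open>Chevalley--Eilenberg cohomology\<close>

text \<open>An \<open>n\<close>-cochain is an alternating \<open>n\<close>-linear map from \<open>g\<close> to \<open>V\<close>, taken as a function on
  lists of length \<open>n\<close> over \<open>g\<close>. The value \<open>0\<close> on all other lists makes the representing
  function unique.\<close>

definition CE_cochains ::
  "('k::field, 'v::ab_group_add) lie_data \<Rightarrow> ('k, 'v, 'w::ab_group_add) lie_module_data
    \<Rightarrow> nat \<Rightarrow> ('v list \<Rightarrow> 'w) set" where
  "CE_cochains g V n = {f.
     (\<forall>xs. length xs = n \<and> set xs \<subseteq> lspace g \<longrightarrow> f xs \<in> mspace V) \<and>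
     (\<forall>xs i x y a b. length xs = n \<and> set xs \<subseteq> lspace g \<and> i < n \<and> x \<in> lspace g \<and> y \<in> lspace g \<longrightarrow>
        f (xs[i := lscale g a x + lscale g b y])
          = mscale V a (f (xs[i := x])) + mscale V b (f (xs[i := y]))) \<and>
     (\<forall>xs i j. length xs = n \<and> set xs \<subseteq> lspace g \<and> i < j \<and> j < n \<and> xs ! i = xs ! j \<longrightarrow> f xs = 0) \<and>
     (\<forall>xs. \<not> (length xs = n \<and> set xs \<subseteq> lspace g) \<longrightarrow> f xs = 0)}"

text \<open>The differential from \<open>n\<close>-cochains to \<open>(n+1)\<close>-cochains, with arguments counted from \<open>0\<close>;
  \<open>nths xs (- {i})\<close> is \<open>xs\<close> without its \<open>i\<close>-th entry.\<close>

definition CE_diff ::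
  "('k::field, 'v::ab_group_add) lie_data \<Rightarrow> ('k, 'v, 'w::ab_group_add) lie_module_data
    \<Rightarrow> nat \<Rightarrow> ('v list \<Rightarrow> 'w) \<Rightarrow> 'v list \<Rightarrow> 'w" where
  "CE_diff g V n f = (\<lambda>xs.
     if length xs = Suc n \<and> set xs \<subseteq> lspace g then
       (\<Sum>i\<le>n. mscale V ((-1) ^ i) (mact V (xs ! i) (f (nths xs (- {i}))))) +
       (\<Sum>j\<le>n. \<Sum>i<j. mscale V ((-1) ^ (i + j))
          (f (lbracket g (xs ! i) (xs ! j) # nths xs (- {i, j}))))
     else 0)"

definition CE_cocycles ::
  "('k::field, 'v::ab_group_add) lie_data \<Rightarrow> ('k, 'v, 'w::ab_group_add) lie_module_data
    \<Rightarrow> nat \<Rightarrow> ('v list \<Rightarrow> 'w) set" where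
  "CE_cocycles g V n = {f \<in> CE_cochains g V n. CE_diff g V n f = (\<lambda>_. 0)}"

definition CE_coboundaries ::
  "('k::field, 'v::ab_group_add) lie_data \<Rightarrow> ('k, 'v, 'w::ab_group_add) lie_module_data
    \<Rightarrow> nat \<Rightarrow> ('v list \<Rightarrow> 'w) set" where
  "CE_coboundaries g V n =
     (case n of 0 \<Rightarrow> {\<lambda>_. 0} | Suc m \<Rightarrow> CE_diff g V m ` CE_cochains g V m)"

text \<open>The quotient of cocycles by coboundaries. Its zero element is the class
  \<open>CE_coboundaries g V n\<close>, so the cohomology vanishes iff
  \<open>CE_cohomology g V n = {CE_coboundaries g V n}\<close>.\<close>

definition CE_cohomology ::
  "('k::field, 'v::ab_group_add) lie_data \<Rightarrow> ('k, 'v, 'w::ab_group_add) lie_module_data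
    \<Rightarrow> nat \<Rightarrow> ('v list \<Rightarrow> 'w) set set" where
  "CE_cohomology g V n = CE_cocycles g V n //
     {(f, h). f \<in> CE_cocycles g V n \<and> h \<in> CE_cocycles g V n \<and>
        (\<lambda>xs. f xs - h xs) \<in> CE_coboundaries g V n}"


section \<open>The mass central extension of the conformal Galilei algebra\<close>

datatype cga_index = eC | eD | eH | eP nat | eM

definition cga_basis :: "real \<Rightarrow> cga_index set" where
  "cga_basis l = {eC, eD, eH, eM} \<union> eP ` {n. real n \<le> 2 * l}"

text \<open>Elements are coordinate functions supported on the basis; \<open>cga_unit i\<close> is a basis element.\<close>

definition cga_unit :: "cga_index \<Rightarrow> cga_index \<Rightarrow> complex" where
  "cga_unit i = (\<lambda>k. if k = i then 1 else 0)"

definition cga_scale :: "complex \<Rightarrow> (cga_index \<Rightarrow> complex) \<Rightarrow> cga_index \<Rightarrow> complex" where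
  "cga_scale a x = (\<lambda>k. a * x k)"

text \<open>For \<open>l \<in> 1/2 + \<nat>\<close> and \<open>m \<le> 2l\<close> the arguments of \<^const>\<open>nat\<close> below are nonnegative integers,
  and nothing is rounded or truncated.\<close>

definition cga_b :: "real \<Rightarrow> nat \<Rightarrow> complex" where
  "cga_b l m = (-1) ^ nat \<lfloor>real m + l + 1 / 2\<rfloor> * fact (nat \<lfloor>2 * l - real m\<rfloor>) * fact m"

text \<open>In \<open>[H, P\<^sub>0]\<close> and \<open>[C, P\<^sub>2\<^sub>l]\<close> the coefficient is \<open>0\<close>, so the index on the right is irrelevant.\<close>

fun cga_bracket_basis :: "real \<Rightarrow> cga_index \<Rightarrow> cga_index \<Rightarrow> cga_index \<Rightarrow> complex" where
  "cga_bracket_basis l eD eH = cga_scale 2 (cga_unit eH)"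
| "cga_bracket_basis l eH eD = cga_scale (- 2) (cga_unit eH)"
| "cga_bracket_basis l eC eH = cga_unit eD"
| "cga_bracket_basis l eH eC = cga_scale (- 1) (cga_unit eD)"
| "cga_bracket_basis l eD eC = cga_scale (- 2) (cga_unit eC)"
| "cga_bracket_basis l eC eD = cga_scale 2 (cga_unit eC)"
| "cga_bracket_basis l eH (eP n) = cga_scale (- of_nat n) (cga_unit (eP (n - 1)))"
| "cga_bracket_basis l (eP n) eH = cga_scale (of_nat n) (cga_unit (eP (n - 1)))"
| "cga_bracket_basis l eD (eP n) = cga_scale (of_real (2 * (l - real n))) (cga_unit (eP n))"
| "cga_bracket_basis l (eP n) eD = cga_scale (- of_real (2 * (l - real n))) (cga_unit (eP n))"
| "cga_bracket_basis l eC (eP n) = cga_scale (of_real (2 * l - real n)) (cga_unit (eP (n + 1)))"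
| "cga_bracket_basis l (eP n) eC = cga_scale (- of_real (2 * l - real n)) (cga_unit (eP (n + 1)))"
| "cga_bracket_basis l (eP m) (eP n) =
     (if real (m + n) = 2 * l then cga_scale (cga_b l m) (cga_unit eM) else 0)"
| "cga_bracket_basis l _ _ = 0"

definition cga_bracket ::
  "real \<Rightarrow> (cga_index \<Rightarrow> complex) \<Rightarrow> (cga_index \<Rightarrow> complex) \<Rightarrow> cga_index \<Rightarrow> complex" where
  "cga_bracket l x y = (\<Sum>i\<in>cga_basis l. \<Sum>j\<in>cga_basis l.
     cga_scale (x i * y j) (cga_bracket_basis l i j))"

definition cga_hat :: "real \<Rightarrow> (complex, cga_index \<Rightarrow> complex) lie_data" where
  "cga_hat l = \<lparr>lspace = {x. \<forall>i. i \<notin> cga_basis l \<longrightarrow> x i = 0},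
     lscale = cga_scale, lbracket = cga_bracket l\<rparr>"


subsection \<open>It is a Lie algebra\<close>

text \<open>The bracket is computed in coordinates. \<open>cga_act\<close> is the action of the \<open>sl\<^sub>2\<close> part of the
  first argument on the \<open>P\<close> part of the second, and \<open>cga_form\<close> the bilinear form giving the
  \<open>M\<close> coordinate; the \<open>M\<close> coordinate of the Jacobi identity is the invariance of this form.\<close>

definition cga_L :: "nat \<Rightarrow> real" where "cga_L k = 1 / 2 + real k"

lemma cga_basis_half:
  "cga_basis (cga_L k) = {eC, eD, eH, eM} \<union> eP ` {..2 * k + 1}"
proof -
  have "real n \<le> 2 * (cga_L k) \<longleftrightarrow> n \<le> 2 * k + 1" for n
    by (simp add: cga_L_def algebra_simps) linarith
  then show ?thesis by (auto simp: cga_basis_def)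
qed

lemma finite_cga_basis: "finite (cga_basis (cga_L k))"
  by (simp add: cga_basis_half)

lemma sum_cga_basis:
  fixes f :: "cga_index \<Rightarrow> complex"
  shows "(\<Sum>i\<in>cga_basis (cga_L k). f i)
     = f eC + f eD + f eH + f eM + (\<Sum>n\<le>2 * k + 1. f (eP n))"
proof -
  have "(\<Sum>i\<in>cga_basis (cga_L k). f i)
      = sum f {eC, eD, eH, eM} + sum f (eP ` {..2 * k + 1})"
    unfolding cga_basis_half by (rule sum.union_disjoint) auto
  also have "sum f (eP ` {..2 * k + 1}) = (\<Sum>n\<le>2 * k + 1. f (eP n))"
    by (subst sum.reindex) (auto simp: inj_on_def)
  finally show ?thesis by (simp add: add.assoc)
qed

lemma cga_sum_apply: "(\<Sum>i\<in>A. F i) k = (\<Sum>i\<in>A. F i k)"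
  for F :: "'i \<Rightarrow> 'j \<Rightarrow> complex"
  by (induction A rule: infinite_finite_induct) auto

lemma cga_bracket_apply:
  "cga_bracket l x y c = (\<Sum>i\<in>cga_basis l. \<Sum>j\<in>cga_basis l.
     x i * y j * cga_bracket_basis l i j c)"
  by (simp add: cga_bracket_def cga_sum_apply cga_scale_def)

lemma cga_b_half:
  "m \<le> 2 * k + 1 \<Longrightarrow> cga_b (cga_L k) m = (-1) ^ (m + k + 1) * fact (2 * k + 1 - m) * fact m"
proof -
  assume m: "m \<le> 2 * k + 1"
  have 1: "nat \<lfloor>real m + (cga_L k) + 1 / 2\<rfloor> = m + k + 1"
    by (simp add: cga_L_def nat_add_distrib)
  have "2 * (cga_L k) - real m = real (2 * k + 1 - m)" using m by (simp add: cga_L_def of_nat_diff)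
  then have 2: "nat \<lfloor>2 * (cga_L k) - real m\<rfloor> = 2 * k + 1 - m" by (simp only:) linarith
  show ?thesis unfolding cga_b_def 1 2 ..
qed

lemma cga_if_M: "(if Q then cga_scale a (cga_unit eM) else 0) c = (if Q \<and> c = eM then a else 0)"
  by (auto simp: cga_scale_def cga_unit_def)

lemma cga_bracket_C: "cga_bracket (cga_L k) x y eC = - 2 * (x eD * y eC - x eC * y eD)"
  unfolding cga_bracket_apply sum_cga_basis
  by (simp add: cga_if_M) (simp add: cga_scale_def cga_unit_def algebra_simps)

lemma cga_bracket_D: "cga_bracket (cga_L k) x y eD = x eC * y eH - x eH * y eC"
  unfolding cga_bracket_apply sum_cga_basis
  by (simp add: cga_if_M) (simp add: cga_scale_def cga_unit_def algebra_simps)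

lemma cga_bracket_H: "cga_bracket (cga_L k) x y eH = 2 * (x eD * y eH - x eH * y eD)"
  unfolding cga_bracket_apply sum_cga_basis
  by (simp add: cga_if_M) (simp add: cga_scale_def cga_unit_def algebra_simps)

definition cga_act :: "nat \<Rightarrow> (cga_index \<Rightarrow> complex) \<Rightarrow> (cga_index \<Rightarrow> complex) \<Rightarrow> nat \<Rightarrow> complex" where
  "cga_act k x y n = - of_nat (n + 1) * x eH * y (eP (n + 1)) + (of_nat (2 * k + 1) - 2 * of_nat n) * x eD * y (eP n)
     + (if n = 0 then 0 else (of_nat (2 * k + 2) - of_nat n) * x eC * y (eP (n - 1)))"

lemma cga_sum_H: 
  fixes f :: "nat \<Rightarrow> complex"
  assumes "f (N+1) = 0" "n \<le> N"
  shows "(\<Sum>m\<le>N. a * f m * (of_nat m * (if n = m - Suc 0 then 1 else 0))) = of_nat (n + 1) * a * f (n + 1)"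
proof -
  have "(\<Sum>m\<le>N. a * f m * (of_nat m * (if n = m - Suc 0 then 1 else 0))) = (\<Sum>m\<le>N+1. if m = n + 1 then of_nat m * a * f m else 0)"
    proof -
    have "(\<Sum>m\<le>N. a * f m * (of_nat m * (if n = m - Suc 0 then 1 else 0))) = (\<Sum>m\<le>N. if m = n + 1 then of_nat m * a * f m else 0)"
      by (intro sum.cong) auto
    moreover have "\<dots> = (\<Sum>m\<le>N+1. if m = n + 1 then of_nat m * a * f m else 0)"
      using assms(1) by (cases "N = n") simp_all
    ultimately show ?thesis by simp
  qed
  also have "\<dots> = of_nat (n + 1) * a * f (n + 1)" using assms(2) by (subst sum.delta) auto
  finally show ?thesis .
qed

lemma cga_sum_C: 
  fixes f :: "nat \<Rightarrow> complex"
  assumes "n \<le> N"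
  shows "(\<Sum>m\<le>N. a * f m * (c m * (if n = Suc m then 1 else 0))) = (if n = 0 then 0 else c (n-1) * a * f (n - 1))"
proof -
  have "(\<Sum>m\<le>N. a * f m * (c m * (if n = Suc m then 1 else 0))) = (\<Sum>m\<le>N. if m = n - 1 then (if n = 0 then 0 else c m * a * f m) else 0)"
    by (intro sum.cong) auto
  also have "\<dots> = (if n = 0 then 0 else c (n-1) * a * f (n - 1))" using assms by (subst sum.delta) auto
  finally show ?thesis .
qed

lemma cga_sum_D: 
  fixes f :: "nat \<Rightarrow> complex"
  assumes "n \<le> N"
  shows "(\<Sum>m\<le>N. a * f m * (c m * (if n = m then 1 else 0))) = c n * a * f n"
  using assms by (simp add: if_distrib [of "\<lambda>t. _ * (_ * t)"] sum.delta cong: if_cong)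

lemma cga_bracket_P_aux:
  assumes "n \<le> 2*k+1" "x (eP (2*k+2)) = 0"  "y (eP (2*k+2)) = 0"
  shows "cga_bracket (cga_L k) x y (eP n) = cga_act k x y n - cga_act k y x n"
proof -
  let ?L = "cga_L k"
  let ?B = "\<lambda>i j. cga_bracket_basis ?L i j (eP n)"
  have z: "?B i j = 0" if "i \<in> {eC,eD,eH,eM}" "j \<in> {eC,eD,eH,eM}" for i j
    using that by (auto simp: cga_scale_def cga_unit_def)
  have z2: "?B (eP m) (eP r) = 0" "?B eM (eP r) = 0" "?B (eP r) eM = 0" for m r
    by (auto simp: cga_scale_def cga_unit_def)
  have bH: "?B eH (eP m) = - (of_nat m * (if n = m - Suc 0 then 1 else 0))"
    "?B (eP m) eH = (of_nat m * (if n = m - Suc 0 then 1 else 0))" for m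
    by (auto simp: cga_scale_def cga_unit_def)
  define cD :: "nat \<Rightarrow> complex" where "cD m = of_nat (2*k+1) - 2 * of_nat m" for m
  define cC :: "nat \<Rightarrow> complex" where "cC m = of_nat (2*k+1) - of_nat m" for m
  have bD: "?B eD (eP m) = cD m * (if n = m then 1 else 0)"
    "?B (eP m) eD = - (cD m * (if n = m then 1 else 0))" for m
    by (auto simp: cga_scale_def cga_unit_def cD_def cga_L_def algebra_simps)
  have bC: "?B eC (eP m) = cC m * (if n = Suc m then 1 else 0)"
    "?B (eP m) eC = - (cC m * (if n = Suc m then 1 else 0))" for m
    by (auto simp: cga_scale_def cga_unit_def cC_def cga_L_def algebra_simps)
  define N where "N = 2 * k + 1"
  have row: "(\<Sum>j\<in>cga_basis ?L. x i * y j * ?B i j) = (\<Sum>m\<le>N. x i * y (eP m) * ?B i (eP m))"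
    if "i \<in> {eC,eD,eH,eM}" for i using z [OF that] by (simp add: sum_cga_basis N_def del: cga_bracket_basis.simps)
  have rowP: "(\<Sum>j\<in>cga_basis ?L. x (eP m) * y j * ?B (eP m) j) =
     x (eP m) * y eC * ?B (eP m) eC + x (eP m) * y eD * ?B (eP m) eD + x (eP m) * y eH * ?B (eP m) eH" for m
    by (simp add: sum_cga_basis z2 del: cga_bracket_basis.simps)
  have A: "cga_bracket ?L x y (eP n) = 
     (\<Sum>m\<le>N. x eC * y (eP m) * ?B eC (eP m)) + (\<Sum>m\<le>N. x eD * y (eP m) * ?B eD (eP m)) + (\<Sum>m\<le>N. x eH * y (eP m) * ?B eH (eP m))
     + ((\<Sum>m\<le>N. x (eP m) * y eC * ?B (eP m) eC) + (\<Sum>m\<le>N. x (eP m) * y eD * ?B (eP m) eD) + (\<Sum>m\<le>N. x (eP m) * y eH * ?B (eP m) eH))"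
    unfolding cga_bracket_apply sum_cga_basis [where f = "\<lambda>i. \<Sum>j\<in>cga_basis ?L. x i * y j * ?B i j"]
    by (simp add: row rowP z2 sum.distrib N_def del: cga_bracket_basis.simps)
  have n: "n \<le> N" using assms by (simp add: N_def)
  have y0: "y (eP (N+1)) = 0" "x (eP (N+1)) = 0" using assms by (simp_all add: N_def)
  note s = cga_sum_H [where N = N and n = n and f = "\<lambda>m. y (eP m)", OF y0(1) n]  cga_sum_H [where N = N and n = n and f = "\<lambda>m. x (eP m)", OF y0(2) n]
     cga_sum_C [OF n, where f = "\<lambda>m. y (eP m)"] cga_sum_C [OF n, where f = "\<lambda>m. x (eP m)"]
     cga_sum_D [OF n, where f = "\<lambda>m. y (eP m)"] cga_sum_D [OF n, where f = "\<lambda>m. x (eP m)"]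
  have com: "x (eP m) * b * c = b * x (eP m) * c" for m b c by simp
  have cs: "cC (n - 1) = of_nat (2*k+2) - of_nat n" if "n \<noteq> 0" using that by (cases n) (auto simp: cC_def)
  show ?thesis
    unfolding A bH bD bC mult_minus_right sum_negf com [of _ "y _"] s cga_act_def cD_def[symmetric]
    by (simp add: cs cD_def cC_def algebra_simps)
qed

definition cga_form :: "nat \<Rightarrow> (nat \<Rightarrow> complex) \<Rightarrow> (nat \<Rightarrow> complex) \<Rightarrow> complex" where
  "cga_form k u v = (\<Sum>m\<le>2*k+1. (-1) ^ (m + k + 1) * fact (2 * k + 1 - m) * fact m * u m * v (2*k+1-m))"

lemma cga_bracket_M: "cga_bracket (cga_L k) x y eM = cga_form k (\<lambda>m. x (eP m)) (\<lambda>m. y (eP m))"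
proof -
  let ?L = "cga_L k"
  let ?B = "\<lambda>i j. cga_bracket_basis ?L i j eM"
  have z: "?B i j = 0" if "i \<in> {eC,eD,eH,eM}" for i j
    using that by (cases j) (auto simp: cga_scale_def cga_unit_def)
  have z2: "?B i j = 0" if "j \<in> {eC,eD,eH,eM}" for i j
    using that by (cases i) (auto simp: cga_scale_def cga_unit_def)
  have e: "real (m + r) = 2 * ?L \<longleftrightarrow> r + m = 2*k+1" for m r by (simp add: cga_L_def algebra_simps) linarith
  have P: "?B (eP m) (eP r) = (if r = 2*k+1 - m then cga_b ?L m else 0)" if "m \<le> 2*k+1" "r \<le> 2*k+1" for m r
    using that unfolding cga_bracket_basis.simps e by (auto simp: cga_scale_def cga_unit_def)
  have "cga_bracket ?L x y eM = (\<Sum>m\<le>2*k+1. \<Sum>r\<le>2*k+1. x (eP m) * y (eP r) * ?B (eP m) (eP r))"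
    by (simp add: cga_bracket_apply z z2 sum_cga_basis del: cga_bracket_basis.simps)
  also have "\<dots> = (\<Sum>m\<le>2*k+1. \<Sum>r\<le>2*k+1. if r = 2*k+1 - m then x (eP m) * y (eP r) * cga_b ?L m else 0)"
    by (intro sum.cong refl) (auto simp: P simp del: cga_bracket_basis.simps)
  also have "\<dots> = cga_form k (\<lambda>m. x (eP m)) (\<lambda>m. y (eP m))"
    unfolding cga_form_def by (intro sum.cong refl) (subst sum.delta, auto simp: cga_b_half)
  finally show ?thesis .
qed

lemma cga_form_antisym: "cga_form k u v = - cga_form k v u"
proof -
  have "cga_form k u v = (\<Sum>m\<le>2*k+1. (-1) ^ (2*k+1-m + k + 1) * fact (2 * k + 1 - (2*k+1-m)) * fact (2*k+1-m) * u (2*k+1-m) * v (2*k+1-(2*k+1-m)))"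
    unfolding cga_form_def
    by (rule sum.reindex_bij_witness [where i = "\<lambda>m. 2*k+1-m" and j = "\<lambda>m. 2*k+1-m"]) auto
  also have "\<dots> = (\<Sum>m\<le>2*k+1. - ((-1) ^ (m + k + 1) * fact (2 * k + 1 - m) * fact m * v m * u (2*k+1-m)))"
  proof (intro sum.cong refl)
    fix m assume m: "m \<in> {..2*k+1}"
    have "(-1::complex) ^ (2*k+1-m + k + 1) = - ((-1) ^ (m + k + 1))"
      using m by (cases "even m"; cases "even k") (auto simp: minus_one_power_iff)
    then show "(-1) ^ (2*k+1-m + k + 1) * fact (2 * k + 1 - (2*k+1-m)) * fact (2*k+1-m) * u (2*k+1-m) * v (2*k+1-(2*k+1-m))
      = - ((-1) ^ (m + k + 1) * fact (2 * k + 1 - m) * fact m * v m * u (2*k+1-m))"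
      using m by simp
  qed
  finally show ?thesis by (simp add: cga_form_def sum_negf)
qed

lemma cga_form_diff: "cga_form k (\<lambda>n. u n - u' n) v = cga_form k u v - cga_form k u' v"
  "cga_form k v (\<lambda>n. u n - u' n) = cga_form k v u - cga_form k v u'"
  unfolding cga_form_def sum_subtractf [symmetric] by (simp_all only: algebra_simps)

lemma cga_form_invariant:
  assumes u: "u (eP (2*k+2)) = 0" and v: "v (eP (2*k+2)) = 0"
  shows "cga_form k (cga_act k y u) (\<lambda>m. v (eP m)) + cga_form k (\<lambda>m. u (eP m)) (cga_act k y v) = 0"
proof -
  define N where "N = 2 * k + 1"
  define b :: "nat \<Rightarrow> complex" where "b m = (-1) ^ (m + k + 1) * fact (N - m) * fact m" for m
  have cga_form: "cga_form k f g = (\<Sum>m\<le>N. b m * f m * g (N - m))" for f g by (simp add: cga_form_def b_def N_def)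
  have b_Suc: "of_nat (Suc m) * b m + of_nat (N - m) * b (Suc m) = 0" if "m < N" for m
  proof -
    have "fact (N - m) = (of_nat (N - m) * fact (N - Suc m) :: complex)"
      using that fact_reduce [of "N - m"] by (simp del: of_nat_diff)
    then show ?thesis by (simp only: b_def) (simp add: algebra_simps del: of_nat_diff)
  qed
  have u0: "u (eP (Suc N)) = 0" and v0: "v (eP (Suc N)) = 0" using u v by (simp_all add: N_def)
  let ?u = "\<lambda>m. u (eP m)" and ?v = "\<lambda>m. v (eP m)"
  have H: "(\<Sum>m\<le>N. b m * (of_nat (m+1) * ?u (m+1)) * ?v (N-m)) + (\<Sum>m\<le>N. b m * ?u m * (of_nat (N-m+1) * ?v (N-m+1))) = 0"
  proof -
    have "(\<Sum>m\<le>N. b m * (of_nat (m+1) * ?u (m+1)) * ?v (N-m)) = (\<Sum>m<N. b m * (of_nat (m+1) * ?u (m+1)) * ?v (N-m))"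
      by (simp add: lessThan_Suc_atMost [symmetric] u0)
    moreover have "(\<Sum>m\<le>N. b m * ?u m * (of_nat (N-m+1) * ?v (N-m+1))) = (\<Sum>m<N. b (Suc m) * ?u (Suc m) * (of_nat (N-m) * ?v (N-m)))"
    proof -
      have "(\<Sum>m\<le>N. b m * ?u m * (of_nat (N-m+1) * ?v (N-m+1))) = (\<Sum>m<N. b (Suc m) * ?u (Suc m) * (of_nat (N-Suc m+1) * ?v (N-Suc m+1)))"
        by (subst sum.atMost_shift) (simp add: v0)
      also have "\<dots> = (\<Sum>m<N. b (Suc m) * ?u (Suc m) * (of_nat (N-m) * ?v (N-m)))"
        by (intro sum.cong refl) (simp add: Suc_diff_Suc)
      finally show ?thesis .
    qed
    moreover have "(\<Sum>m<N. b m * (of_nat (m+1) * ?u (m+1)) * ?v (N-m) + b (Suc m) * ?u (Suc m) * (of_nat (N-m) * ?v (N-m))) = 0"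
    proof (intro sum.neutral ballI)
      fix m assume "m \<in> {..<N}"
      then have "of_nat (Suc m) * b m + of_nat (N - m) * b (Suc m) = 0" by (intro b_Suc) simp
      then have "(of_nat (Suc m) * b m + of_nat (N - m) * b (Suc m)) * (?u (Suc m) * ?v (N-m)) = 0" by simp
      then show "b m * (of_nat (m+1) * ?u (m+1)) * ?v (N-m) + b (Suc m) * ?u (Suc m) * (of_nat (N-m) * ?v (N-m)) = 0"
        by (simp add: algebra_simps)
    qed
    ultimately show ?thesis by (simp only: sum.distrib)
  qed
  have C: "(\<Sum>m\<le>N. b m * (if m = 0 then 0 else of_nat (N + 1 - m) * ?u (m-1)) * ?v (N-m))
     + (\<Sum>m\<le>N. b m * ?u m * (if N - m = 0 then 0 else of_nat (m + 1) * ?v (N-m-1))) = 0"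
  proof -
    have "(\<Sum>m\<le>N. b m * (if m = 0 then 0 else of_nat (N + 1 - m) * ?u (m-1)) * ?v (N-m)) 
        = (\<Sum>m<N. b (Suc m) * (of_nat (N - m) * ?u m) * ?v (N - Suc m))"
      by (subst sum.atMost_shift) simp
    moreover have "(\<Sum>m\<le>N. b m * ?u m * (if N - m = 0 then 0 else of_nat (m + 1) * ?v (N-m-1)))
       = (\<Sum>m<N. b m * ?u m * (of_nat (m + 1) * ?v (N- Suc m)))"
      by (simp add: lessThan_Suc_atMost [symmetric])
    moreover have "(\<Sum>m<N. b (Suc m) * (of_nat (N - m) * ?u m) * ?v (N - Suc m) + b m * ?u m * (of_nat (m + 1) * ?v (N- Suc m))) = 0"
    proof (intro sum.neutral ballI)
      fix m assume "m \<in> {..<N}"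
      then have "of_nat (Suc m) * b m + of_nat (N - m) * b (Suc m) = 0" by (intro b_Suc) simp
      then have "(of_nat (Suc m) * b m + of_nat (N - m) * b (Suc m)) * (?u m * ?v (N - Suc m)) = 0" by simp
      then show "b (Suc m) * (of_nat (N - m) * ?u m) * ?v (N - Suc m) + b m * ?u m * (of_nat (m + 1) * ?v (N- Suc m)) = 0"
        by (simp add: algebra_simps)
    qed
    ultimately show ?thesis by (simp only: sum.distrib)
  qed
  have "cga_form k (cga_act k y u) ?v + cga_form k ?u (cga_act k y v) = (\<Sum>m\<le>N. b m * cga_act k y u m * ?v (N-m) + b m * ?u m * cga_act k y v (N-m))"
    by (simp add: cga_form sum.distrib)
  also have "\<dots> = (\<Sum>m\<le>N.
       - y eH * (b m * (of_nat (m+1) * ?u (m+1)) * ?v (N-m) + b m * ?u m * (of_nat (N-m+1) * ?v (N-m+1)))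
     + y eC * (b m * (if m = 0 then 0 else of_nat (N + 1 - m) * ?u (m-1)) * ?v (N-m) + b m * ?u m * (if N - m = 0 then 0 else of_nat (m + 1) * ?v (N-m-1))))"
  proof (intro sum.cong refl)
    fix m assume "m \<in> {..N}"
    then have m: "m \<le> N" by simp
    define r where "r = N - m"
    have N: "of_nat (2*k+1) = (of_nat m + of_nat r :: complex)" "of_nat (2*k+2) = (of_nat m + of_nat r + 1 :: complex)"
      "N + 1 - m = r + 1"
      using m by (simp_all add: r_def N_def of_nat_diff Suc_diff_le)
    show "b m * cga_act k y u m * ?v (N-m) + b m * ?u m * cga_act k y v (N-m) = 
       - y eH * (b m * (of_nat (m+1) * ?u (m+1)) * ?v (N-m) + b m * ?u m * (of_nat (N-m+1) * ?v (N-m+1)))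
     + y eC * (b m * (if m = 0 then 0 else of_nat (N + 1 - m) * ?u (m-1)) * ?v (N-m) + b m * ?u m * (if N - m = 0 then 0 else of_nat (m + 1) * ?v (N-m-1)))"
      unfolding cga_act_def r_def [symmetric] N by (simp add: algebra_simps)
  qed
  also have "\<dots> = 0"
    unfolding sum.distrib sum_distrib_left [symmetric] H C by simp
  finally show ?thesis .
qed

definition cga_space :: "nat \<Rightarrow> (cga_index \<Rightarrow> complex) set" where
  "cga_space k = {x. \<forall>i. i \<notin> cga_basis (cga_L k) \<longrightarrow> x i = 0}"

lemma cga_space_P: "x \<in> cga_space k \<Longrightarrow> n > 2*k+1 \<Longrightarrow> x (eP n) = 0"
  unfolding cga_space_def cga_basis_half by (auto dest!: spec [of _ "eP n"])

lemma cga_bracket_basis_closed: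
  assumes "i \<in> cga_basis (cga_L k)" "j \<in> cga_basis (cga_L k)" "c \<notin> cga_basis (cga_L k)"
  shows "cga_bracket_basis (cga_L k) i j c = 0"
proof -
  obtain n where n: "c = eP n" "n > 2*k+1"
    using assms(3) unfolding cga_basis_half by (cases c) force+
  show ?thesis
  proof (cases "(i = eC \<and> j = eP (2*k+1)) \<or> (j = eC \<and> i = eP (2*k+1))")
    case True then show ?thesis by (auto simp: cga_scale_def cga_L_def)
  next
    case False
    then show ?thesis using assms(1,2) n unfolding cga_basis_half
      by (auto simp: cga_scale_def cga_unit_def split: if_splits)
  qed
qed

lemma cga_bracket_in: "cga_bracket (cga_L k) x y \<in> cga_space k"
  unfolding cga_space_def cga_bracket_apply
  by (auto intro!: sum.neutral simp: cga_bracket_basis_closed)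

lemma cga_space_eqI:
  assumes "x \<in> cga_space k" "y \<in> cga_space k"
    "x eC = y eC" "x eD = y eD" "x eH = y eH" "x eM = y eM" "\<And>n. n \<le> 2*k+1 \<Longrightarrow> x (eP n) = y (eP n)"
  shows "x = y"
proof
  fix i show "x i = y i"
    using assms(3-) cga_space_P [OF assms(1)] cga_space_P [OF assms(2)] by (cases i) (simp_all, metis not_le)
qed

lemma cga_bracket_P_if:
  assumes "x \<in> cga_space k" "y \<in> cga_space k"
  shows "cga_bracket (cga_L k) x y (eP n) = (if n \<le> 2*k+1 then cga_act k x y n - cga_act k y x n else 0)"
  using cga_bracket_P_aux [of n k x y] cga_space_P [OF assms(1)] cga_space_P [OF assms(2)] cga_space_P [OF cga_bracket_in, of k n x y] by auto

lemma cga_act_out: "x \<in> cga_space k \<Longrightarrow> y \<in> cga_space k \<Longrightarrow> n > 2*k+1 \<Longrightarrow> cga_act k x y n = 0"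
  by (cases "n = 2*k+2") (auto simp: cga_act_def cga_space_P)

lemma cga_bracket_P:
  assumes "x \<in> cga_space k" "y \<in> cga_space k"
  shows "cga_bracket (cga_L k) x y (eP n) = cga_act k x y n - cga_act k y x n"
  using cga_bracket_P_if [OF assms] cga_act_out assms by auto

definition cga_act_vec :: "nat \<Rightarrow> (cga_index \<Rightarrow> complex) \<Rightarrow> (cga_index \<Rightarrow> complex) \<Rightarrow> cga_index \<Rightarrow> complex" where
  "cga_act_vec k x y i = (case i of eP n \<Rightarrow> cga_act k x y n | _ \<Rightarrow> 0)"

lemma cga_act_rep:
  "cga_act k (cga_bracket (cga_L k) y z) w n = cga_act k y (cga_act_vec k z w) n - cga_act k z (cga_act_vec k y w) n"
proof (cases n)
  case 0
  show ?thesis unfolding 0 by (simp add: cga_act_def cga_act_vec_def cga_bracket_C cga_bracket_D cga_bracket_H algebra_simps)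
next
  case (Suc m)
  show ?thesis unfolding Suc
    by (cases m) (simp_all add: cga_act_def cga_act_vec_def cga_bracket_C cga_bracket_D cga_bracket_H algebra_simps)
qed

lemma cga_act_bracket:
  assumes "y \<in> cga_space k" "z \<in> cga_space k"
  shows "cga_act k x (cga_bracket (cga_L k) y z) n = cga_act k x (cga_act_vec k y z) n - cga_act k x (cga_act_vec k z y) n"
  by (simp add: cga_act_def cga_act_vec_def cga_bracket_P [OF assms] right_diff_distrib) 

lemma cga_jacobi:
  assumes x: "x \<in> cga_space k" and y: "y \<in> cga_space k" and z: "z \<in> cga_space k"
  defines "B \<equiv> cga_bracket (cga_L k)"
  shows "B x (B y z) + B y (B z x) + B z (B x y) = 0"
proof (rule cga_space_eqI)
  have add: "u + v \<in> cga_space k" if "u \<in> cga_space k" "v \<in> cga_space k" for u v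
    using that by (simp add: cga_space_def)
  show "B x (B y z) + B y (B z x) + B z (B x y) \<in> cga_space k"
    unfolding B_def by (intro add cga_bracket_in)
  show "0 \<in> cga_space k" by (simp add: cga_space_def)
  note c = cga_bracket_C cga_bracket_D cga_bracket_H
  show "(B x (B y z) + B y (B z x) + B z (B x y)) eC = 0 eC"
    unfolding B_def plus_fun_def c zero_fun_def by algebra
  show "(B x (B y z) + B y (B z x) + B z (B x y)) eD = 0 eD"
    unfolding B_def plus_fun_def c zero_fun_def by algebra
  show "(B x (B y z) + B y (B z x) + B z (B x y)) eH = 0 eH"
    unfolding B_def plus_fun_def c zero_fun_def by algebra
  note P = cga_bracket_P [OF x cga_bracket_in] cga_bracket_P [OF y cga_bracket_in] cga_bracket_P [OF z cga_bracket_in]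
    cga_bracket_P [OF x y] cga_bracket_P [OF y z] cga_bracket_P [OF z x]
  show "(B x (B y z) + B y (B z x) + B z (B x y)) (eP n) = 0 (eP n)" for n
    unfolding B_def plus_fun_def zero_fun_def P cga_act_rep cga_act_bracket [OF x y] cga_act_bracket [OF y z] cga_act_bracket [OF z x] by simp
  let ?p = "\<lambda>x n. x (eP n)"
  have inv: "cga_form k (cga_act k w u) (?p v) = - cga_form k (?p u) (cga_act k w v)" if "u \<in> cga_space k" "v \<in> cga_space k" for w u v
    using cga_form_invariant [of u k v w] that by (simp add: cga_space_P add_eq_0_iff)
  show "(B x (B y z) + B y (B z x) + B z (B x y)) eM = 0 eM"
    unfolding B_def plus_fun_def zero_fun_def cga_bracket_M cga_bracket_P [OF x y] cga_bracket_P [OF y z] cga_bracket_P [OF z x] cga_form_diff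
    using inv [OF x y, of z] inv [OF y z, of x] inv [OF z x, of y]
      cga_form_antisym [of k "?p y" "cga_act k z x"] cga_form_antisym [of k "?p z" "cga_act k x y"] cga_form_antisym [of k "?p x" "cga_act k y z"]
    by algebra
qed

lemma lie_algebra_cga_hat:
  assumes "\<exists>k::nat. l = 1 / 2 + real k"
  shows "lie_algebra (cga_hat l)"
proof -
  obtain k where l: "l = cga_L k" using assms unfolding cga_L_def by blast
  have sp: "lspace (cga_hat l) = cga_space k" by (simp add: cga_hat_def l cga_space_def)
  have sc: "lscale (cga_hat l) = cga_scale" and br: "lbracket (cga_hat l) = cga_bracket (cga_L k)"
    by (simp_all add: cga_hat_def l)
  interpret V: vector_space cga_scale
    by standard (auto simp: cga_scale_def algebra_simps)
  show ?thesis
  proof (unfold_locales, unfold sp sc br)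
    show "V.subspace (cga_space k)"
      by (auto simp: V.subspace_def cga_space_def cga_scale_def)
  next
    fix x :: "cga_index \<Rightarrow> complex" assume x: "x \<in> cga_space k"
    show "cga_bracket (cga_L k) x x = 0"
    proof (rule cga_space_eqI [OF cga_bracket_in])
      show "0 \<in> cga_space k" by (simp add: cga_space_def)
      show "cga_bracket (cga_L k) x x eM = 0 eM"
        using cga_form_antisym [of k "\<lambda>n. x (eP n)" "\<lambda>n. x (eP n)"] by (simp add: cga_bracket_M eq_neg_iff_add_eq_0)
    qed (simp_all add: cga_bracket_C cga_bracket_D cga_bracket_H cga_bracket_P_if x)
  next
    fix x y z assume xyz: "x \<in> cga_space k" "y \<in> cga_space k" "z \<in> cga_space k"
    show "cga_bracket (cga_L k) x (cga_bracket (cga_L k) y z) + cga_bracket (cga_L k) y (cga_bracket (cga_L k) z x)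
       + cga_bracket (cga_L k) z (cga_bracket (cga_L k) x y) = 0"
      by (rule cga_jacobi [OF xyz])
  next
    fix x y z :: "cga_index \<Rightarrow> complex" and a b
    show "cga_bracket (cga_L k) (cga_scale a x + cga_scale b y) z
      = cga_scale a (cga_bracket (cga_L k) x z) + cga_scale b (cga_bracket (cga_L k) y z)"
      by (rule ext) (simp add: cga_scale_def cga_bracket_apply sum.distrib sum_distrib_left algebra_simps)
    show "cga_bracket (cga_L k) z (cga_scale a x + cga_scale b y)
      = cga_scale a (cga_bracket (cga_L k) z x) + cga_scale b (cga_bracket (cga_L k) z y)"
      by (rule ext) (simp add: cga_scale_def cga_bracket_apply sum.distrib sum_distrib_left algebra_simps)
  qed (auto simp: cga_bracket_in cga_scale_def algebra_simps)
qed

end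

theory Submission
  imports Defs
begin

text \<open>
  Write \<open>N = 2k + 1 = 2\<ell>\<close> and let \<open>\<phi>\<close> be a 2-cocycle of the algebra \<open>g\<close> with values in \<open>g\<close>. The
  reason for the vanishing is that \<open>g\<close> is \<open>sl\<^sub>2\<close> acting on a Heisenberg algebra, in which the \<open>P\<^sub>n\<close>
  span an irreducible module \<open>V\<^sub>N\<close> and \<open>M\<close> spans the centre. By Hochschild--Serre a class is represented by an
  \<open>sl\<^sub>2\<close>-invariant cochain on the Heisenberg algebra. As \<open>N\<close> is odd, neither \<open>sl\<^sub>2\<close> nor \<open>V\<^sub>N\<close> occurs
  in \<open>\<Lambda>\<^sup>2 V\<^sub>N\<close>, so only two invariant cochains exist: \<open>(P\<^sub>m, P\<^sub>n) \<mapsto> \<omega>(P\<^sub>m, P\<^sub>n) M\<close>, which is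
  a coboundary, and \<open>(P\<^sub>n, M) \<mapsto> P\<^sub>n\<close>, which is not closed.

  The proof below carries this out by weights, with no cohomology of \<open>sl\<^sub>2\<close> as input. The element
  \<open>D\<close> acts diagonally, and Cartan's homotopy formula for \<open>D\<close> shows that up to a coboundary \<open>\<phi>\<close>
  preserves weights (\<open>cga_cocycle2_graded_representative\<close>). The weights of \<open>C, D, H, M\<close> are even,
  those of the \<open>P\<^sub>n\<close> are odd and distinct; hence a weight-preserving cochain is given by very few
  scalars: \<open>\<phi>(H, P\<^sub>n)\<close> is a multiple of \<open>P\<^sub>n\<^sub>-\<^sub>1\<close>, and so on. The coboundary of a
  weight-preserving endomorphism then removes \<open>\<phi>(D, H)\<close>, \<open>\<phi>(C, H)\<close>, \<open>\<phi>(H, M)\<close>, all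
  \<open>\<phi>(H, P\<^sub>n)\<close> and the \<open>M\<close> part of \<open>\<phi>(P\<^sub>0, P\<^sub>N)\<close> (\<open>cga_graded_cocycle2_normal_form\<close>), and the
  cocycle identities leave nothing else (\<open>cga_normalized_cocycle2_unit\<close>): most of them are first-order
  recursions in \<open>n\<close>, whose solution vanishes because it does so at an end of the chain
  \<open>P\<^sub>0, \<dots>, P\<^sub>N\<close>, or in its middle, where the oddness of \<open>N\<close> enters.
\<close>

section \<open>Second cohomology with adjoint coefficients in curried form\<close>

definition linear_endo :: "('k::field, 'v::ab_group_add) lie_data \<Rightarrow> ('v \<Rightarrow> 'v) \<Rightarrow> bool" where
  "linear_endo g u \<longleftrightarrow> (\<forall>x\<in>lspace g. u x \<in> lspace g) \<and>
     (\<forall>x\<in>lspace g. \<forall>y\<in>lspace g. \<forall>a b.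
        u (lscale g a x + lscale g b y) = lscale g a (u x) + lscale g b (u y))"

definition coboundary1 ::
  "('k::field, 'v::ab_group_add) lie_data \<Rightarrow> ('v \<Rightarrow> 'v) \<Rightarrow> 'v \<Rightarrow> 'v \<Rightarrow> 'v" where
  "coboundary1 g u x y = lbracket g x (u y) - lbracket g y (u x) - u (lbracket g x y)"

text \<open>The cyclic sums are the alternating sums of the differential, rewritten with the skew symmetry
  of the bracket and of \<open>\<phi>\<close>.\<close>

definition cocycle2 ::
  "('k::field, 'v::ab_group_add) lie_data \<Rightarrow> ('v \<Rightarrow> 'v \<Rightarrow> 'v) \<Rightarrow> bool" where
  "cocycle2 g \<phi> \<longleftrightarrow>
     (\<forall>x\<in>lspace g. linear_endo g (\<phi> x) \<and> linear_endo g (\<lambda>y. \<phi> y x) \<and> \<phi> x x = 0) \<and>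
     (\<forall>x\<in>lspace g. \<forall>y\<in>lspace g. \<forall>z\<in>lspace g.
        lbracket g x (\<phi> y z) + lbracket g y (\<phi> z x) + lbracket g z (\<phi> x y)
          = \<phi> (lbracket g x y) z + \<phi> (lbracket g y z) x + \<phi> (lbracket g z x) y)"

lemma list2_cases:
  assumes "length xs = 2"
  obtains x y where "xs = [x, y]"
  using assms that by (auto simp: numeral_2_eq_2 length_Suc_conv)

lemma list3_cases:
  assumes "length xs = 3"
  obtains x y z where "xs = [x, y, z]"
  using assms that by (auto simp: numeral_3_eq_3 length_Suc_conv)

lemma nths_two: "nths [x, y] (- {0}) = [y]" "nths [x, y] (- {Suc 0}) = [x]"
    "nths [x, y] (- {0, Suc 0}) = []"
  by (simp_all add: nths_Cons)

lemma nths_three: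
    "nths [x, y, z] (- {0}) = [y, z]" "nths [x, y, z] (- {Suc 0}) = [x, z]"
    "nths [x, y, z] (- {2}) = [x, y]" "nths [x, y, z] (- {0, Suc 0}) = [z]"
    "nths [x, y, z] (- {0, 2}) = [y]" "nths [x, y, z] (- {Suc 0, 2}) = [x]"
  by (simp_all add: nths_Cons)

context lie_algebra
begin

abbreviation "L \<equiv> lspace g"
abbreviation "B \<equiv> lbracket g"

lemma L_closed:
  "0 \<in> L" "x \<in> L \<Longrightarrow> y \<in> L \<Longrightarrow> x + y \<in> L" "x \<in> L \<Longrightarrow> y \<in> L \<Longrightarrow> x - y \<in> L"
  "x \<in> L \<Longrightarrow> - x \<in> L" "x \<in> L \<Longrightarrow> lscale g a x \<in> L" "x \<in> L \<Longrightarrow> y \<in> L \<Longrightarrow> B x y \<in> L"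
  using lspace_subspace subspace_diff subspace_neg bracket_closed
  by (auto simp: subspace_def)

lemma linear_endo_simps:
  assumes "linear_endo g u"
  shows "x \<in> L \<Longrightarrow> u x \<in> L"
    and "x \<in> L \<Longrightarrow> y \<in> L \<Longrightarrow> u (x + y) = u x + u y"
    and "x \<in> L \<Longrightarrow> u (lscale g a x) = lscale g a (u x)"
    and "x \<in> L \<Longrightarrow> u (- x) = - u x"
    and "x \<in> L \<Longrightarrow> y \<in> L \<Longrightarrow> u (x - y) = u x - u y"
    and "u 0 = 0"
proof -
  have lin: "u (lscale g a x + lscale g b y) = lscale g a (u x) + lscale g b (u y)"
    if "x \<in> L" "y \<in> L" for x y a b
    using assms that by (auto simp: linear_endo_def)
  show "x \<in> L \<Longrightarrow> u x \<in> L" using assms by (simp add: linear_endo_def)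
  show "x \<in> L \<Longrightarrow> y \<in> L \<Longrightarrow> u (x + y) = u x + u y" using lin[of x y 1 1] by simp
  show sc: "x \<in> L \<Longrightarrow> u (lscale g a x) = lscale g a (u x)" for a x
    using lin[of x x a 0] by simp
  show "x \<in> L \<Longrightarrow> u (- x) = - u x" using sc[of x "-1"] by simp
  show "x \<in> L \<Longrightarrow> y \<in> L \<Longrightarrow> u (x - y) = u x - u y" using lin[of x y 1 "-1"] by simp
  show "u 0 = 0" using sc[of 0 0] by (simp add: L_closed)
qed

lemma linear_endo_bracket:
  "x \<in> L \<Longrightarrow> linear_endo g (B x)" "x \<in> L \<Longrightarrow> linear_endo g (\<lambda>y. B y x)"
  by (simp_all add: linear_endo_def bracket_closed bracket_linear_left bracket_linear_right)

lemma linear_endo_add: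
  "linear_endo g u \<Longrightarrow> linear_endo g v \<Longrightarrow> linear_endo g (\<lambda>x. u x + v x)"
  by (simp add: linear_endo_def L_closed scale_right_distrib)

lemma linear_endo_diff:
  "linear_endo g u \<Longrightarrow> linear_endo g v \<Longrightarrow> linear_endo g (\<lambda>x. u x - v x)"
  by (simp add: linear_endo_def L_closed scale_right_diff_distrib)

lemma linear_endo_compose:
  "linear_endo g u \<Longrightarrow> linear_endo g v \<Longrightarrow> linear_endo g (\<lambda>x. u (v x))"
  by (simp add: linear_endo_def)

lemmas bracket_simps =
  linear_endo_simps[OF linear_endo_bracket(1)] linear_endo_simps[OF linear_endo_bracket(2)]

lemma bracket_skew:
  assumes "x \<in> L" "y \<in> L"
  shows "B y x = - B x y"
proof -
  have "0 = B (x + y) (x + y)" using assms by (simp add: bracket_self L_closed)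
  also have "\<dots> = B y x + B x y"
    using assms by (simp only: bracket_simps L_closed) (simp add: bracket_self)
  finally show ?thesis by (simp add: eq_neg_iff_add_eq_0)
qed

text \<open>The Jacobi identity oriented as a rewrite rule: it expands every bracket whose first argument
  is a bracket.\<close>

lemma bracket_leibniz:
  assumes "x \<in> L" "y \<in> L" "z \<in> L"
  shows "B (B x y) z = B x (B y z) - B y (B x z)"
proof -
  have "B z (B x y) = - B (B x y) z" "B z x = - B x z"
    using assms by (auto intro!: bracket_skew L_closed)
  then have "B x (B y z) - B y (B x z) - B (B x y) z = 0"
    using jacobi[OF assms] assms by (simp add: bracket_simps L_closed)
  then show ?thesis by simp
qed

lemma cocycle2_simps:
  assumes "cocycle2 g \<phi>"
  shows "x \<in> L \<Longrightarrow> linear_endo g (\<phi> x)" "x \<in> L \<Longrightarrow> linear_endo g (\<lambda>y. \<phi> y x)"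
    "x \<in> L \<Longrightarrow> \<phi> x x = 0"
    "x \<in> L \<Longrightarrow> y \<in> L \<Longrightarrow> z \<in> L \<Longrightarrow> B x (\<phi> y z) + B y (\<phi> z x) + B z (\<phi> x y)
          = \<phi> (B x y) z + \<phi> (B y z) x + \<phi> (B z x) y"
  using assms unfolding cocycle2_def by blast+

lemma alternating_skew:
  assumes \<phi>: "\<And>x. x \<in> L \<Longrightarrow> linear_endo g (\<phi> x)" "\<And>x. x \<in> L \<Longrightarrow> linear_endo g (\<lambda>y. \<phi> y x)"
      "\<And>x. x \<in> L \<Longrightarrow> \<phi> x x = 0"
    and "x \<in> L" "y \<in> L"
  shows "\<phi> y x = - \<phi> x y"
proof -
  have "0 = \<phi> (x + y) (x + y)" using assms by (simp add: L_closed)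
  also have "\<dots> = \<phi> (x + y) x + \<phi> (x + y) y"
    using assms by (intro linear_endo_simps(2)[OF \<phi>(1)] L_closed)
  also have "\<dots> = (\<phi> x x + \<phi> y x) + (\<phi> x y + \<phi> y y)"
    using assms by (intro arg_cong2[where f = "(+)"] linear_endo_simps(2)[OF \<phi>(2)])
  also have "\<dots> = \<phi> y x + \<phi> x y" using assms by simp
  finally show ?thesis by (simp add: eq_neg_iff_add_eq_0)
qed

lemma cocycle2_skew: "cocycle2 g \<phi> \<Longrightarrow> x \<in> L \<Longrightarrow> y \<in> L \<Longrightarrow> \<phi> y x = - \<phi> x y"
  by (rule alternating_skew[where \<phi> = \<phi>, OF cocycle2_simps(1-3)[where \<phi> = \<phi>]])

lemma cocycle2_diff:
  assumes "cocycle2 g \<phi>" "cocycle2 g \<psi>"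
  shows "cocycle2 g (\<lambda>x y. \<phi> x y - \<psi> x y)"
  unfolding cocycle2_def
proof (intro conjI ballI)
  note c = cocycle2_simps[OF assms(1)] cocycle2_simps[OF assms(2)]
  fix x y z assume x: "x \<in> L" and y: "y \<in> L" and z: "z \<in> L"
  have val: "\<phi> v w \<in> L" "\<psi> v w \<in> L" if "v \<in> L" "w \<in> L" for v w
    using that c(1,5) by (auto simp: linear_endo_def)
  show "B x (\<phi> y z - \<psi> y z) + B y (\<phi> z x - \<psi> z x) + B z (\<phi> x y - \<psi> x y) =
       \<phi> (B x y) z - \<psi> (B x y) z + (\<phi> (B y z) x - \<psi> (B y z) x) + (\<phi> (B z x) y - \<psi> (B z x) y)"
    using c(4)[OF x y z] c(8)[OF x y z] x y z
    by (simp add: bracket_simps val algebra_simps)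
  show "linear_endo g (\<lambda>y. \<phi> x y - \<psi> x y)"
    by (rule linear_endo_diff[OF c(1)[OF x] c(5)[OF x]])
  show "linear_endo g (\<lambda>y. \<phi> y x - \<psi> y x)"
    by (rule linear_endo_diff[OF c(2)[OF x] c(6)[OF x]])
  show "\<phi> x x - \<psi> x x = 0" by (simp add: c(3)[OF x] c(7)[OF x])
qed

text \<open>This is \<open>d\<^sup>2 = 0\<close> in degree one. After expansion by the Leibniz rule, all terms cancel in pairs
  except the image under \<open>u\<close> of a Jacobi sum.\<close>

lemma cocycle2_coboundary1:
  assumes u: "linear_endo g u"
  shows "cocycle2 g (coboundary1 g u)"
  unfolding cocycle2_def
proof (intro conjI ballI)
  fix x assume x: "x \<in> L"
  note e = linear_endo_bracket[OF x] linear_endo_bracket[OF linear_endo_simps(1)[OF u x]]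
  show "linear_endo g (coboundary1 g u x)" "linear_endo g (\<lambda>y. coboundary1 g u y x)"
    unfolding coboundary1_def
    by (intro linear_endo_diff e u linear_endo_compose[OF e(1) u] linear_endo_compose[OF e(2) u]
      linear_endo_compose[OF u e(1)] linear_endo_compose[OF u e(2)])+
  show "coboundary1 g u x x = 0"
    using x by (simp add: coboundary1_def bracket_self linear_endo_simps[OF u])
next
  fix x y z assume x: "x \<in> L" and y: "y \<in> L" and z: "z \<in> L"
  note closed = x y z linear_endo_simps(1)[OF u] L_closed
  have "u (B (B x y) z) + u (B (B y z) x) + u (B (B z x) y) = u (B (B x y) z + B (B y z) x + B (B z x) y)"
    by (simp add: closed linear_endo_simps[OF u])
  also have "B (B x y) z + B (B y z) x + B (B z x) y = - (B x (B y z) + B y (B z x) + B z (B x y))"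
    by (simp add: bracket_skew[of _ "B _ _"] closed)
  finally have J: "u (B (B x y) z) + u (B (B y z) x) + u (B (B z x) y) = 0"
    by (simp add: jacobi closed linear_endo_simps[OF u])
  have lb: "B (B v w) (u t) = B v (B w (u t)) - B w (B v (u t))" if "v \<in> L" "w \<in> L" "t \<in> L" for v w t
    using that by (intro bracket_leibniz) (auto simp: closed)
  show "B x (coboundary1 g u y z) + B y (coboundary1 g u z x) + B z (coboundary1 g u x y)
      = coboundary1 g u (B x y) z + coboundary1 g u (B y z) x + coboundary1 g u (B z x) y"
    using J by (simp add: coboundary1_def bracket_simps closed lb algebra_simps)
qed

lemma CE_cocycles_2_iff:
  "f \<in> CE_cocycles g (adjoint_module g) 2 \<longleftrightarrow> cocycle2 g (\<lambda>x y. f [x, y]) \<and>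
     (\<forall>xs. \<not> (length xs = 2 \<and> set xs \<subseteq> L) \<longrightarrow> f xs = 0)" (is "?lhs \<longleftrightarrow> ?rhs")
proof -
  have diff: "CE_diff g (adjoint_module g) 2 f [x, y, z] =
      B x (f [y, z]) - B y (f [x, z]) + B z (f [x, y])
       - f [B x y, z] + f [B x z, y] - f [B y z, x]"
    if "x \<in> L" "y \<in> L" "z \<in> L" for x y z
    using that
    by (simp add: CE_diff_def adjoint_module_def numeral_2_eq_2 nths_three[simplified numeral_2_eq_2])
  have swap: "B x (f [y, z]) - B y (f [x, z]) + B z (f [x, y]) - f [B x y, z] + f [B x z, y] - f [B y z, x] = 0
     \<longleftrightarrow> B x (f [y, z]) + B y (f [z, x]) + B z (f [x, y]) = f [B x y, z] + f [B y z, x] + f [B z x, y]"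
    if \<phi>: "\<And>x. x \<in> L \<Longrightarrow> linear_endo g (\<lambda>y. f [x, y])" "\<And>x. x \<in> L \<Longrightarrow> linear_endo g (\<lambda>y. f [y, x])"
      "\<And>x. x \<in> L \<Longrightarrow> f [x, x] = 0" and xyz: "x \<in> L" "y \<in> L" "z \<in> L" for x y z
  proof -
    have "f [z, x] = - f [x, z]"
      by (rule alternating_skew[where \<phi> = "\<lambda>x y. f [x, y]", OF \<phi> xyz(1,3)])
    moreover have "B z x = - B x z" by (rule bracket_skew[OF xyz(1,3)])
    moreover have "f [x, z] \<in> L" using \<phi>(1) xyz by (auto simp: linear_endo_def)
    ultimately show ?thesis
      using xyz linear_endo_simps(4)[OF \<phi>(2)[OF xyz(2)], of "B x z"]
      by (simp add: bracket_simps L_closed algebra_simps)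
  qed
  show ?thesis
  proof
    assume f: ?lhs
    then have ch: "f \<in> CE_cochains g (adjoint_module g) 2" and d: "CE_diff g (adjoint_module g) 2 f = (\<lambda>_. 0)"
      by (auto simp: CE_cocycles_def)
    have closed: "f [x, y] \<in> L" if "x \<in> L" "y \<in> L" for x y
      using ch that by (simp add: CE_cochains_def adjoint_module_def)
    have lin: "f (xs[i := lscale g a x + lscale g b y])
          = lscale g a (f (xs[i := x])) + lscale g b (f (xs[i := y]))"
      if "length xs = 2" "set xs \<subseteq> L" "i < 2" "x \<in> L" "y \<in> L" for xs i x y a b
      using ch that by (auto simp: CE_cochains_def adjoint_module_def)
    have l: "linear_endo g (\<lambda>y. f [x, y])" "linear_endo g (\<lambda>y. f [y, x])" if "x \<in> L" for x
      using lin[of "[x, x]" 1] lin[of "[x, x]" 0] closed that by (auto simp: linear_endo_def)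
    have alt: "f [x, x] = 0" if "x \<in> L" for x
    proof -
      have "\<forall>xs i j. length xs = 2 \<and> set xs \<subseteq> L \<and> i < j \<and> j < 2 \<and> xs ! i = xs ! j \<longrightarrow> f xs = 0"
        using ch by (simp add: CE_cochains_def)
      from this[rule_format, of "[x, x]" 0 1] that show ?thesis by simp
    qed
    have "cocycle2 g (\<lambda>x y. f [x, y])"
      unfolding cocycle2_def using l alt swap[OF l alt] diff d by (simp add: fun_eq_iff)
    then show ?rhs using ch by (auto simp: CE_cochains_def)
  next
    assume f: ?rhs
    note c = cocycle2_simps[OF conjunct1[OF f]]
    have ch: "f \<in> CE_cochains g (adjoint_module g) 2"
      unfolding CE_cochains_def
    proof (intro CollectI conjI allI impI)
      fix xs assume "length xs = 2 \<and> set xs \<subseteq> L"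
      then show "f xs \<in> mspace (adjoint_module g)"
        using c(1) by (auto simp: adjoint_module_def linear_endo_def elim!: list2_cases)
    next
      fix xs and i :: nat and x y a b
      assume "length xs = 2 \<and> set xs \<subseteq> L \<and> i < 2 \<and> x \<in> L \<and> y \<in> L"
      then show "f (xs[i := lscale g a x + lscale g b y])
          = mscale (adjoint_module g) a (f (xs[i := x])) + mscale (adjoint_module g) b (f (xs[i := y]))"
        using c(1,2) by (auto simp: adjoint_module_def linear_endo_def less_2_cases_iff elim!: list2_cases)
    next
      fix xs and i j :: nat
      assume "length xs = 2 \<and> set xs \<subseteq> L \<and> i < j \<and> j < 2 \<and> xs ! i = xs ! j"
      then show "f xs = 0"
        using c(3) by (auto simp: less_2_cases_iff elim!: list2_cases)
    next
      fix xs assume "\<not> (length xs = 2 \<and> set xs \<subseteq> L)"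
      then show "f xs = 0" using f by blast
    qed
    have "CE_diff g (adjoint_module g) 2 f xs = 0" for xs
    proof (cases "length xs = 3 \<and> set xs \<subseteq> L")
      case True
      then obtain x y z where xs: "xs = [x, y, z]" by (auto elim: list3_cases)
      then have "x \<in> L" "y \<in> L" "z \<in> L" using True by auto
      then show ?thesis using diff swap[OF c(1-3)] c(4) by (simp add: xs)
    next
      case False
      then show ?thesis by (auto simp: CE_diff_def)
    qed
    with ch show ?lhs by (auto simp: CE_cocycles_def)
  qed
qed

lemma CE_coboundaries_2_iff:
  "f \<in> CE_coboundaries g (adjoint_module g) 2 \<longleftrightarrow>
     (\<exists>u. linear_endo g u \<and> (\<forall>x\<in>L. \<forall>y\<in>L. f [x, y] = coboundary1 g u x y)) \<and>
     (\<forall>xs. \<not> (length xs = 2 \<and> set xs \<subseteq> L) \<longrightarrow> f xs = 0)" (is "?lhs \<longleftrightarrow> ?rhs")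
proof -
  have diff: "CE_diff g (adjoint_module g) 1 h [x, y] = B x (h [y]) - B y (h [x]) - h [B x y]"
    if "x \<in> L" "y \<in> L" for h x y
    using that by (simp add: CE_diff_def adjoint_module_def nths_two)
  have out: "CE_diff g (adjoint_module g) 1 h xs = 0" if "\<not> (length xs = 2 \<and> set xs \<subseteq> L)" for h xs
    using that by (auto simp: CE_diff_def numeral_2_eq_2)
  have B2: "CE_coboundaries g (adjoint_module g) 2
      = CE_diff g (adjoint_module g) 1 ` CE_cochains g (adjoint_module g) 1"
    by (simp add: CE_coboundaries_def numeral_2_eq_2)
  show ?thesis
  proof
    assume ?lhs
    then obtain h where h: "h \<in> CE_cochains g (adjoint_module g) 1"
      and f: "f = CE_diff g (adjoint_module g) 1 h" unfolding B2 by blast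
    have lin: "\<forall>xs i x y a b. length xs = 1 \<and> set xs \<subseteq> L \<and> i < 1 \<and> x \<in> L \<and> y \<in> L \<longrightarrow>
        h (xs[i := lscale g a x + lscale g b y])
          = lscale g a (h (xs[i := x])) + lscale g b (h (xs[i := y]))"
      using h by (auto simp: CE_cochains_def adjoint_module_def)
    have "h [lscale g a x + lscale g b y] = lscale g a (h [x]) + lscale g b (h [y])"
      if "x \<in> L" "y \<in> L" for x y a b
      using lin[rule_format, of "[x]" 0 x y a b] that by simp
    moreover have "h [x] \<in> L" if "x \<in> L" for x
      using h that by (simp add: CE_cochains_def adjoint_module_def)
    ultimately have "linear_endo g (\<lambda>x. h [x])" by (simp add: linear_endo_def)
    then show ?rhs using diff out unfolding f coboundary1_def by (intro conjI exI[of _ "\<lambda>x. h [x]"]) auto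
  next
    assume r: ?rhs
    then obtain u where u: "linear_endo g u" "\<forall>x\<in>L. \<forall>y\<in>L. f [x, y] = coboundary1 g u x y" by blast
    define h where "h xs = (if length xs = 1 \<and> set xs \<subseteq> L then u (hd xs) else 0)" for xs
    have "h \<in> CE_cochains g (adjoint_module g) 1"
      unfolding CE_cochains_def adjoint_module_def
    proof (intro CollectI conjI allI impI)
      fix xs and i :: nat and x y a b
      assume "length xs = 1 \<and> set xs \<subseteq> L \<and> i < 1 \<and> x \<in> L \<and> y \<in> L"
      then show "h (xs[i := lscale g a x + lscale g b y])
          = mscale \<lparr>mspace = L, mscale = lscale g, mact = B\<rparr> a (h (xs[i := x]))
            + mscale \<lparr>mspace = L, mscale = lscale g, mact = B\<rparr> b (h (xs[i := y]))"
        using u(1) by (auto simp: h_def length_Suc_conv linear_endo_def L_closed)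
    qed (use u(1) in \<open>auto simp: h_def length_Suc_conv linear_endo_def\<close>)
    moreover have "f xs = CE_diff g (adjoint_module g) 1 h xs" for xs
    proof (cases "length xs = 2 \<and> set xs \<subseteq> L")
      case True
      then obtain x y where xs: "xs = [x, y]" by (auto elim: list2_cases)
      then have "x \<in> L" "y \<in> L" using True by auto
      then show ?thesis using u(2) diff by (simp add: xs coboundary1_def h_def L_closed)
    next
      case False
      then show ?thesis using r out by auto
    qed
    ultimately show ?lhs unfolding B2 by blast
  qed
qed

lemma cocycle2_cong:
  assumes "cocycle2 g \<phi>" "\<And>x y. x \<in> L \<Longrightarrow> y \<in> L \<Longrightarrow> \<psi> x y = \<phi> x y"
  shows "cocycle2 g \<psi>"
  using assms(1) unfolding cocycle2_def linear_endo_def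
  by (simp add: assms(2) L_closed)

text \<open>The quotient is the set of classes of cocycles; it is a singleton because any two cocycles
  are cohomologous, and that class is the set of coboundaries because \<open>d\<^sup>2 = 0\<close>.\<close>

lemma CE_cohomology_2_vanishes:
  assumes "\<And>\<phi>. cocycle2 g \<phi> \<Longrightarrow> \<exists>u. linear_endo g u \<and> (\<forall>x\<in>L. \<forall>y\<in>L. \<phi> x y = coboundary1 g u x y)"
  shows "CE_cohomology g (adjoint_module g) 2 = {CE_coboundaries g (adjoint_module g) 2}"
proof -
  let ?Z = "CE_cocycles g (adjoint_module g) 2" and ?B = "CE_coboundaries g (adjoint_module g) 2"
  have ZB: "?Z = ?B"
  proof (intro equalityI subsetI)
    fix f assume "f \<in> ?Z"
    then show "f \<in> ?B" using assms unfolding CE_cocycles_2_iff CE_coboundaries_2_iff by blast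
  next
    fix f assume "f \<in> ?B"
    then show "f \<in> ?Z" unfolding CE_cocycles_2_iff CE_coboundaries_2_iff
      by (auto intro: cocycle2_cong[OF cocycle2_coboundary1])
  qed
  have zero: "(\<lambda>_. 0) \<in> ?Z"
    unfolding CE_cocycles_2_iff cocycle2_def
    by (simp add: linear_endo_def L_closed linear_endo_simps[OF linear_endo_bracket(1)])
  have diff: "(\<lambda>xs. f xs - h xs) \<in> ?Z" if "f \<in> ?Z" "h \<in> ?Z" for f h
    using that unfolding CE_cocycles_2_iff by (auto intro: cocycle2_diff)
  have "CE_cohomology g (adjoint_module g) 2 = ?Z // (?Z \<times> ?Z)"
    unfolding CE_cohomology_def using diff ZB by (intro arg_cong2[where f = "(//)"]) auto
  also have "\<dots> = {?Z}" using zero by (auto simp: quotient_def)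
  finally show ?thesis by (simp add: ZB)
qed

end

section \<open>Brackets with basis elements\<close>

lemma cga_hat_simps [simp]:
  "lspace (cga_hat (cga_L k)) = cga_space k" "lscale (cga_hat (cga_L k)) = cga_scale"
  "lbracket (cga_hat (cga_L k)) = cga_bracket (cga_L k)"
  by (simp_all add: cga_hat_def cga_space_def)

interpretation cga: lie_algebra "cga_hat (cga_L k)" for k
  by (rule lie_algebra_cga_hat) (auto simp: cga_L_def)

abbreviation "cga_basis_of k \<equiv> cga_basis (cga_L k)"
abbreviation "cga_br k \<equiv> cga_bracket (cga_L k)"

lemma cga_basis_mem [simp]:
  "eC \<in> cga_basis_of k" "eD \<in> cga_basis_of k" "eH \<in> cga_basis_of k" "eM \<in> cga_basis_of k"
  "eP n \<in> cga_basis_of k \<longleftrightarrow> n \<le> 2 * k + 1"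
  by (auto simp: cga_basis_half)

lemma cga_unit_space [simp]: "cga_unit i \<in> cga_space k \<longleftrightarrow> i \<in> cga_basis_of k"
  by (auto simp: cga_space_def cga_unit_def)

lemma cga_space_outside: "x \<in> cga_space k \<Longrightarrow> i \<notin> cga_basis_of k \<Longrightarrow> x i = 0"
  by (simp add: cga_space_def)

lemma cga_b_nonzero: "cga_b l m \<noteq> 0"
  by (simp add: cga_b_def)

lemma cga_b_last: "cga_b (cga_L k) (2 * k + 1) = - cga_b (cga_L k) 0"
  using cga_b_half[of "2 * k + 1" k] cga_b_half[of 0 k] by (simp add: power_add power_mult)

lemma cga_bracket_unit:
  assumes "i \<in> cga_basis_of k" "j \<in> cga_basis_of k"
  shows "cga_br k (cga_unit i) (cga_unit j) = cga_bracket_basis (cga_L k) i j"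
proof
  fix c
  have "cga_br k (cga_unit i) (cga_unit j) c
      = (\<Sum>i'\<in>cga_basis_of k. \<Sum>j'\<in>cga_basis_of k.
          if i' = i then if j' = j then cga_bracket_basis (cga_L k) i j c else 0 else 0)"
    unfolding cga_bracket_apply cga_unit_def by (intro sum.cong) auto
  also have "\<dots> = (\<Sum>i'\<in>cga_basis_of k. if i' = i then cga_bracket_basis (cga_L k) i j c else 0)"
    by (intro sum.cong) (simp_all add: finite_cga_basis assms)
  finally show "cga_br k (cga_unit i) (cga_unit j) c = cga_bracket_basis (cga_L k) i j c"
    by (simp add: finite_cga_basis assms)
qed

text \<open>The eigenvalue of \<open>ad D\<close>. It is an integer, so that equations between weights, in particular
  parity questions, can be decided in Presburger arithmetic.\<close>

fun cga_weight :: "nat \<Rightarrow> cga_index \<Rightarrow> int" where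
  "cga_weight k eC = - 2" | "cga_weight k eD = 0" | "cga_weight k eH = 2"
| "cga_weight k (eP n) = 2 * int k + 1 - 2 * int n" | "cga_weight k eM = 0"

lemma cga_ad_sl2_coords:
  assumes y: "y \<in> cga_space k"
  shows cga_ad_D: "cga_br k (cga_unit eD) y i = of_int (cga_weight k i) * y i"
    and cga_ad_H: "cga_br k (cga_unit eH) y i = (case i of eD \<Rightarrow> - y eC | eH \<Rightarrow> - 2 * y eD
          | eP n \<Rightarrow> - of_nat (n + 1) * y (eP (n + 1)) | _ \<Rightarrow> 0)"
    and cga_ad_C: "cga_br k (cga_unit eC) y i = (case i of eC \<Rightarrow> 2 * y eD | eD \<Rightarrow> y eH
          | eP n \<Rightarrow> if n = 0 then 0 else (of_nat (2 * k + 2) - of_nat n) * y (eP (n - 1)) | _ \<Rightarrow> 0)"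
    and cga_ad_M: "cga_br k (cga_unit eM) y i = 0"
proof -
  have M: "cga_br k (cga_unit j) y eM = 0" if "\<forall>n. j \<noteq> eP n" for j
  proof -
    have "cga_unit j (eP m) = 0" for m using that by (auto simp: cga_unit_def)
    then show ?thesis by (simp only: cga_bracket_M cga_form_def mult_zero_left mult_zero_right sum.neutral_const)
  qed
  show "cga_br k (cga_unit eD) y i = of_int (cga_weight k i) * y i"
    by (cases i) (simp_all add: cga_bracket_C cga_bracket_D cga_bracket_H M cga_bracket_P y,
        simp_all add: cga_unit_def cga_act_def algebra_simps)
  show "cga_br k (cga_unit eH) y i = (case i of eD \<Rightarrow> - y eC | eH \<Rightarrow> - 2 * y eD
          | eP n \<Rightarrow> - of_nat (n + 1) * y (eP (n + 1)) | _ \<Rightarrow> 0)"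
    by (cases i) (simp_all add: cga_bracket_C cga_bracket_D cga_bracket_H M cga_bracket_P y,
        simp_all add: cga_unit_def cga_act_def algebra_simps)
  show "cga_br k (cga_unit eC) y i = (case i of eC \<Rightarrow> 2 * y eD | eD \<Rightarrow> y eH
          | eP n \<Rightarrow> if n = 0 then 0 else (of_nat (2 * k + 2) - of_nat n) * y (eP (n - 1)) | _ \<Rightarrow> 0)"
    by (cases i) (simp_all add: cga_bracket_C cga_bracket_D cga_bracket_H M cga_bracket_P y,
        simp_all add: cga_unit_def cga_act_def algebra_simps)
  show "cga_br k (cga_unit eM) y i = 0"
    by (cases i) (simp_all add: cga_bracket_C cga_bracket_D cga_bracket_H M cga_bracket_P y,
        simp_all add: cga_unit_def cga_act_def algebra_simps)
qed

lemma cga_ad_P_M: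
  assumes "m \<le> 2 * k + 1"
  shows "cga_br k (cga_unit (eP m)) y eM = cga_b (cga_L k) m * y (eP (2 * k + 1 - m))"
proof -
  have "cga_br k (cga_unit (eP m)) y eM
      = (\<Sum>n\<le>2 * k + 1. if n = m then cga_b (cga_L k) m * y (eP (2 * k + 1 - m)) else 0)"
    unfolding cga_bracket_M cga_form_def
    by (intro sum.cong) (auto simp: cga_unit_def cga_b_half)
  then show ?thesis using assms by simp
qed

text \<open>The bracket \<open>[C, P\<^sub>n]\<close> for \<open>n = N\<close> is a case of its own: there \<open>P\<^sub>n\<^sub>+\<^sub>1\<close> lies outside the
  algebra, and linearity of a cochain does not apply to the product \<open>0 P\<^sub>n\<^sub>+\<^sub>1\<close>.\<close>

lemma cga_bracket_units [simp]:
  "cga_br k (cga_unit eC) (cga_unit eH) = cga_unit eD"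
  "cga_br k (cga_unit eH) (cga_unit eC) = cga_scale (- 1) (cga_unit eD)"
  "i \<in> cga_basis_of k \<Longrightarrow> cga_br k (cga_unit i) (cga_unit eM) = 0"
  "i \<in> cga_basis_of k \<Longrightarrow> cga_br k (cga_unit eM) (cga_unit i) = 0"
  "n \<le> 2 * k + 1 \<Longrightarrow> cga_br k (cga_unit eH) (cga_unit (eP n)) = cga_scale (- of_nat n) (cga_unit (eP (n - 1)))"
  "n \<le> 2 * k + 1 \<Longrightarrow> cga_br k (cga_unit (eP n)) (cga_unit eH) = cga_scale (of_nat n) (cga_unit (eP (n - 1)))"
  "n \<le> 2 * k \<Longrightarrow> cga_br k (cga_unit eC) (cga_unit (eP n)) = cga_scale (of_nat (2 * k + 1 - n)) (cga_unit (eP (n + 1)))"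
  "n \<le> 2 * k \<Longrightarrow> cga_br k (cga_unit (eP n)) (cga_unit eC) = cga_scale (- of_nat (2 * k + 1 - n)) (cga_unit (eP (n + 1)))"
  "n = 2 * k + 1 \<Longrightarrow> cga_br k (cga_unit eC) (cga_unit (eP n)) = 0"
  "n = 2 * k + 1 \<Longrightarrow> cga_br k (cga_unit (eP n)) (cga_unit eC) = 0"
  "i \<in> cga_basis_of k \<Longrightarrow> cga_br k (cga_unit eD) (cga_unit i) = cga_scale (of_int (cga_weight k i)) (cga_unit i)"
  "i \<in> cga_basis_of k \<Longrightarrow> cga_br k (cga_unit i) (cga_unit eD) = cga_scale (- of_int (cga_weight k i)) (cga_unit i)"
  "m \<le> 2 * k + 1 \<Longrightarrow> n \<le> 2 * k + 1 \<Longrightarrow> cga_br k (cga_unit (eP m)) (cga_unit (eP n))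
     = (if m + n = 2 * k + 1 then cga_scale (cga_b (cga_L k) m) (cga_unit eM) else 0)"
proof -
  show "i \<in> cga_basis_of k \<Longrightarrow> cga_br k (cga_unit i) (cga_unit eM) = 0"
     "i \<in> cga_basis_of k \<Longrightarrow> cga_br k (cga_unit eM) (cga_unit i) = 0"
     "i \<in> cga_basis_of k \<Longrightarrow> cga_br k (cga_unit eD) (cga_unit i) = cga_scale (of_int (cga_weight k i)) (cga_unit i)"
     "i \<in> cga_basis_of k \<Longrightarrow> cga_br k (cga_unit i) (cga_unit eD) = cga_scale (- of_int (cga_weight k i)) (cga_unit i)"
    by (cases i; simp add: cga_bracket_unit; simp add: cga_L_def cga_scale_def fun_eq_iff algebra_simps)+
qed (simp_all add: cga_bracket_unit, auto simp: cga_L_def cga_scale_def fun_eq_iff algebra_simps of_nat_diff)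

section \<open>Linear maps given on the basis\<close>

definition cga_lin :: "nat \<Rightarrow> (cga_index \<Rightarrow> cga_index \<Rightarrow> complex) \<Rightarrow>
    (cga_index \<Rightarrow> complex) \<Rightarrow> cga_index \<Rightarrow> complex" where
  "cga_lin k T x i = (\<Sum>j\<in>cga_basis_of k. x j * T j i)"

lemma linear_endo_cga_lin:
  assumes "\<And>j. j \<in> cga_basis_of k \<Longrightarrow> T j \<in> cga_space k"
  shows "linear_endo (cga_hat (cga_L k)) (cga_lin k T)"
  using assms
  by (auto simp: linear_endo_def cga_space_def cga_lin_def fun_eq_iff cga_scale_def
      sum.distrib sum_distrib_left algebra_simps intro!: sum.neutral)

lemma cga_lin_unit [simp]: "j \<in> cga_basis_of k \<Longrightarrow> cga_lin k T (cga_unit j) = T j"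
  by (simp add: cga_lin_def cga_unit_def fun_eq_iff finite_cga_basis if_distrib[of "\<lambda>t. t * _"] cong: if_cong)

lemma cga_lin_0:
  assumes "\<And>j. j \<in> cga_basis_of k \<Longrightarrow> T j = 0"
  shows "cga_lin k T x = 0"
  using assms by (auto simp: cga_lin_def fun_eq_iff intro!: sum.neutral)

lemma cga_lin_scale [simp]: "cga_lin k T (cga_scale a x) = cga_scale a (cga_lin k T x)"
  by (simp add: cga_lin_def fun_eq_iff cga_scale_def sum_distrib_left algebra_simps)

lemma linear_endo_eq_cga_lin:
  assumes u: "linear_endo (cga_hat (cga_L k)) u" and x: "x \<in> cga_space k"
  shows "u x = cga_lin k (\<lambda>j. u (cga_unit j)) x"
proof -
  have A: "(\<Sum>j\<in>A. cga_scale (x j) (cga_unit j)) \<in> cga_space k \<and>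
      u (\<Sum>j\<in>A. cga_scale (x j) (cga_unit j)) = (\<Sum>j\<in>A. cga_scale (x j) (u (cga_unit j)))"
    if "finite A" "A \<subseteq> cga_basis_of k" for A
    using that
  proof (induction A)
    case empty
    then show ?case using cga.linear_endo_simps(6)[OF u] cga.L_closed(1)[of k] by (simp add: zero_fun_def)
  next
    case (insert a A)
    have a: "cga_unit a \<in> cga_space k" "cga_scale (x a) (cga_unit a) \<in> cga_space k"
      using insert.prems cga.L_closed(5)[of "cga_unit a" k] by auto
    show ?case
      using insert a cga.linear_endo_simps(2,3)[OF u] cga.L_closed(2)[where k = k]
      by (simp del: plus_fun_apply plus_fun_def)
  qed
  have "x = (\<Sum>j\<in>cga_basis_of k. cga_scale (x j) (cga_unit j))"
  proof
    fix i
    have "(\<Sum>j\<in>cga_basis_of k. cga_scale (x j) (cga_unit j)) i = (\<Sum>j\<in>cga_basis_of k. if j = i then x j else 0)"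
      unfolding cga_sum_apply by (intro sum.cong) (auto simp: cga_scale_def cga_unit_def)
    also have "\<dots> = x i" using x by (simp add: finite_cga_basis cga_space_outside)
    finally show "x i = (\<Sum>j\<in>cga_basis_of k. cga_scale (x j) (cga_unit j)) i" by simp
  qed
  then have "u x = (\<Sum>j\<in>cga_basis_of k. cga_scale (x j) (u (cga_unit j)))"
    using A[OF finite_cga_basis order_refl] by simp
  then show ?thesis by (simp add: fun_eq_iff cga_sum_apply cga_lin_def cga_scale_def)
qed

section \<open>Weight spaces and reduction to weight-preserving cocycles\<close>

definition cga_wspace :: "nat \<Rightarrow> int \<Rightarrow> (cga_index \<Rightarrow> complex) set" where
  "cga_wspace k c = {x \<in> cga_space k. \<forall>i. x i \<noteq> 0 \<longrightarrow> cga_weight k i = c}"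

lemma cga_wspace_iff:
  "x \<in> cga_wspace k c \<longleftrightarrow> x \<in> cga_space k \<and> cga_br k (cga_unit eD) x = cga_scale (of_int c) x"
  by (auto simp: cga_wspace_def cga_ad_D fun_eq_iff cga_scale_def)

lemma cga_wspace_diff: "x \<in> cga_wspace k c \<Longrightarrow> y \<in> cga_wspace k c \<Longrightarrow> x - y \<in> cga_wspace k c"
  using cga.L_closed(3)[of x k y] by (auto simp: cga_wspace_def) metis

lemma cga_wspace_unit [simp]: "i \<in> cga_basis_of k \<Longrightarrow> cga_unit i \<in> cga_wspace k (cga_weight k i)"
  using cga_unit_space[of i k] by (auto simp: cga_wspace_def cga_unit_def simp del: cga_unit_space)

lemma cga_wspace_coord: "x \<in> cga_wspace k c \<Longrightarrow> cga_weight k i \<noteq> c \<Longrightarrow> x i = 0"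
  by (auto simp: cga_wspace_def)

lemma cga_wspace_eq_0:
  assumes "x \<in> cga_wspace k c" "\<And>i. i \<in> cga_basis_of k \<Longrightarrow> cga_weight k i = c \<Longrightarrow> x i = 0"
  shows "x = 0"
  using assms by (auto simp: cga_wspace_def fun_eq_iff cga_space_def)

lemma cga_wspace_bracket:
  assumes "x \<in> cga_wspace k a" "y \<in> cga_wspace k b"
  shows "cga_br k x y \<in> cga_wspace k (a + b)"
proof -
  have s: "x \<in> cga_space k" "y \<in> cga_space k" and D: "cga_unit eD \<in> cga_space k"
    and e: "cga_br k (cga_unit eD) x = cga_scale (of_int a) x"
      "cga_br k (cga_unit eD) y = cga_scale (of_int b) y"
    using assms by (auto simp: cga_wspace_iff)
  have "cga_br k (cga_unit eD) (cga_br k x y)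
      = cga_br k (cga_br k (cga_unit eD) x) y + cga_br k x (cga_br k (cga_unit eD) y)"
    using cga.bracket_leibniz[of "cga_unit eD" k x y] s by simp
  also have "\<dots> = cga_scale (of_int (a + b)) (cga_br k x y)"
    unfolding e using cga.bracket_simps(3)[of x k y] cga.bracket_simps(9)[of y k x] s
    by (simp add: fun_eq_iff cga_scale_def algebra_simps)
  finally show ?thesis using s by (simp add: cga_wspace_iff cga_bracket_in)
qed

lemma cga_wspace_lin:
  assumes T: "\<And>j. j \<in> cga_basis_of k \<Longrightarrow> T j \<in> cga_wspace k (cga_weight k j)"
    and x: "x \<in> cga_wspace k c"
  shows "cga_lin k T x \<in> cga_wspace k c"
proof -
  have "linear_endo (cga_hat (cga_L k)) (cga_lin k T)"
    using T by (intro linear_endo_cga_lin) (auto simp: cga_wspace_def)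
  then have "cga_lin k T x \<in> cga_space k" using x by (simp add: linear_endo_def cga_wspace_def)
  moreover have "cga_lin k T x i = 0" if "cga_weight k i \<noteq> c" for i
    unfolding cga_lin_def
  proof (intro sum.neutral ballI)
    fix j assume "j \<in> cga_basis_of k"
    then show "x j * T j i = 0"
      using that T[of j] x by (cases "cga_weight k j = c") (auto dest: cga_wspace_coord)
  qed
  ultimately show ?thesis by (auto simp: cga_wspace_def)
qed

definition cga_graded :: "nat \<Rightarrow> ((cga_index \<Rightarrow> complex) \<Rightarrow> (cga_index \<Rightarrow> complex) \<Rightarrow> cga_index \<Rightarrow> complex) \<Rightarrow> bool" where
  "cga_graded k \<phi> \<longleftrightarrow> (\<forall>i\<in>cga_basis_of k. \<forall>j\<in>cga_basis_of k.
     \<phi> (cga_unit i) (cga_unit j) \<in> cga_wspace k (cga_weight k i + cga_weight k j))"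

lemma cga_gradedD:
  "cga_graded k \<phi> \<Longrightarrow> i \<in> cga_basis_of k \<Longrightarrow> j \<in> cga_basis_of k \<Longrightarrow>
     \<phi> (cga_unit i) (cga_unit j) \<in> cga_wspace k (cga_weight k i + cga_weight k j)"
  by (simp add: cga_graded_def)

lemma cga_graded_diff: "cga_graded k \<phi> \<Longrightarrow> cga_graded k \<psi> \<Longrightarrow> cga_graded k (\<lambda>x y. \<phi> x y - \<psi> x y)"
  by (simp add: cga_graded_def cga_wspace_diff)

lemma cga_graded_coboundary1:
  assumes T: "\<And>j. j \<in> cga_basis_of k \<Longrightarrow> T j \<in> cga_wspace k (cga_weight k j)"
  shows "cga_graded k (coboundary1 (cga_hat (cga_L k)) (cga_lin k T))"
  unfolding cga_graded_def
proof (intro ballI)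
  fix i j assume i: "i \<in> cga_basis_of k" and j: "j \<in> cga_basis_of k"
  have "cga_br k (cga_unit j) (T i) \<in> cga_wspace k (cga_weight k i + cga_weight k j)"
    using cga_wspace_bracket[OF cga_wspace_unit[OF j] T[OF i]] by (simp add: add.commute)
  then show "coboundary1 (cga_hat (cga_L k)) (cga_lin k T) (cga_unit i) (cga_unit j)
      \<in> cga_wspace k (cga_weight k i + cga_weight k j)"
    using i j by (simp add: coboundary1_def cga_wspace_diff cga_wspace_bracket cga_wspace_lin[OF T] T)
qed

lemma cga_cocycle2_expand:
  assumes \<phi>: "cocycle2 (cga_hat (cga_L k)) \<phi>" and x: "x \<in> cga_space k" and y: "y \<in> cga_space k"
    and z: "\<And>i j. i \<in> cga_basis_of k \<Longrightarrow> j \<in> cga_basis_of k \<Longrightarrow> \<phi> (cga_unit i) (cga_unit j) = 0"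
  shows "\<phi> x y = 0"
proof -
  have "\<phi> (cga_unit i) y = 0" if i: "i \<in> cga_basis_of k" for i
  proof -
    have "linear_endo (cga_hat (cga_L k)) (\<phi> (cga_unit i))" using cga.cocycle2_simps(1)[OF \<phi>] i by simp
    from linear_endo_eq_cga_lin[OF this y] show ?thesis using z[OF i] by (simp add: cga_lin_0)
  qed
  moreover have "linear_endo (cga_hat (cga_L k)) (\<lambda>x. \<phi> x y)" using cga.cocycle2_simps(2)[OF \<phi>] y by simp
  from linear_endo_eq_cga_lin[OF this x]
  have "\<phi> x y = cga_lin k (\<lambda>j. \<phi> (cga_unit j) y) x" .
  ultimately show ?thesis by (simp add: cga_lin_0)
qed

text \<open>Evaluate the cocycle identity at \<open>D, e\<^sub>i, e\<^sub>j\<close>: the terms containing \<open>\<phi>(e\<^sub>i, e\<^sub>j)\<close> add up to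
  \<open>(ad D - w\<^sub>i - w\<^sub>j) \<phi>(e\<^sub>i, e\<^sub>j)\<close>, and all others contain \<open>\<phi>(D, -)\<close> and so have weight
  \<open>w\<^sub>i + w\<^sub>j\<close>. Hence a component of \<open>\<phi>(e\<^sub>i, e\<^sub>j)\<close> of another weight vanishes.\<close>

lemma cga_graded_cocycle2:
  assumes \<phi>: "cocycle2 (cga_hat (cga_L k)) \<phi>"
    and D: "\<And>i. i \<in> cga_basis_of k \<Longrightarrow> \<phi> (cga_unit eD) (cga_unit i) \<in> cga_wspace k (cga_weight k i)"
  shows "cga_graded k \<phi>"
  unfolding cga_graded_def
proof (intro ballI)
  fix i j assume i: "i \<in> cga_basis_of k" and j: "j \<in> cga_basis_of k"
  let ?D = "cga_unit eD" and ?x = "cga_unit i" and ?y = "cga_unit j"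
  let ?w = "cga_weight k i + cga_weight k j"
  have s: "?D \<in> cga_space k" "?x \<in> cga_space k" "?y \<in> cga_space k" "cga_br k ?x ?y \<in> cga_space k"
    using i j by (simp_all add: cga_bracket_in)
  note lin = cga.linear_endo_simps[OF cga.cocycle2_simps(1)[OF \<phi>], unfolded cga_hat_simps]
    cga.linear_endo_simps[OF cga.cocycle2_simps(2)[OF \<phi>], unfolded cga_hat_simps]
  note skew = cga.cocycle2_skew[OF \<phi>, unfolded cga_hat_simps]
  have "linear_endo (cga_hat (cga_L k)) (\<phi> ?D)" using cga.cocycle2_simps(1)[OF \<phi>] s by simp
  from linear_endo_eq_cga_lin[OF this s(4)]
  have "\<phi> ?D (cga_br k ?x ?y) \<in> cga_wspace k ?w"
    using cga_wspace_lin[OF D cga_wspace_bracket[OF cga_wspace_unit[OF i] cga_wspace_unit[OF j]]] by simp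
  moreover have "cga_br k ?x (\<phi> ?D ?y) \<in> cga_wspace k ?w"
    by (rule cga_wspace_bracket[OF cga_wspace_unit[OF i] D[OF j]])
  moreover have "cga_br k ?y (\<phi> ?D ?x) \<in> cga_wspace k ?w"
    using cga_wspace_bracket[OF cga_wspace_unit[OF j] D[OF i]] by (simp add: add.commute)
  ultimately have R: "cga_br k ?x (\<phi> ?D ?y) - cga_br k ?y (\<phi> ?D ?x) - \<phi> ?D (cga_br k ?x ?y) \<in> cga_wspace k ?w"
    by (intro cga_wspace_diff)
  have val: "\<phi> ?x ?y \<in> cga_space k" "\<phi> ?D ?y \<in> cga_space k" using lin(1) s by auto
  have "cga_br k ?D (\<phi> ?x ?y) + cga_br k ?x (\<phi> ?y ?D) + cga_br k ?y (\<phi> ?D ?x)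
      = \<phi> (cga_br k ?D ?x) ?y + \<phi> (cga_br k ?x ?y) ?D + \<phi> (cga_br k ?y ?D) ?x"
    using cga.cocycle2_simps(4)[OF \<phi>, of ?D ?x ?y] s by simp
  moreover have "\<phi> (cga_br k ?D ?x) ?y = cga_scale (of_int (cga_weight k i)) (\<phi> ?x ?y)"
    using i lin(9)[OF s(3,2)] by simp
  moreover have "\<phi> (cga_br k ?y ?D) ?x = cga_scale (of_int (cga_weight k j)) (\<phi> ?x ?y)"
    using j by (simp add: lin(9)[OF s(2,3)] skew[OF s(2,3)]) (simp add: cga_scale_def fun_eq_iff)
  moreover have "\<phi> (cga_br k ?x ?y) ?D = - \<phi> ?D (cga_br k ?x ?y)"
    by (rule skew[OF s(1,4)])
  moreover have "cga_br k ?x (\<phi> ?y ?D) = - cga_br k ?x (\<phi> ?D ?y)"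
    using skew[OF s(1,3)] cga.bracket_simps(4)[of ?x k] s val by simp
  ultimately have eq: "cga_br k ?D (\<phi> ?x ?y) - cga_scale (of_int ?w) (\<phi> ?x ?y)
     = cga_br k ?x (\<phi> ?D ?y) - cga_br k ?y (\<phi> ?D ?x) - \<phi> ?D (cga_br k ?x ?y)"
    by (simp add: fun_eq_iff cga_scale_def algebra_simps)
  have "\<phi> ?x ?y c = 0" if "cga_weight k c \<noteq> ?w" for c
  proof -
    have "(of_int (cga_weight k c) - of_int ?w) * \<phi> ?x ?y c = 0"
      using cga_wspace_coord[OF R that] fun_cong[OF eq, of c] val
      by (simp add: cga_ad_D cga_scale_def algebra_simps)
    moreover have "of_int (cga_weight k c) - of_int ?w \<noteq> (0 :: complex)"
      using that by (metis eq_iff_diff_eq_0 of_int_eq_iff)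
    ultimately show ?thesis by simp
  qed
  then show "\<phi> ?x ?y \<in> cga_wspace k ?w" using val by (auto simp: cga_wspace_def)
qed

text \<open>For an endomorphism \<open>u\<close> with \<open>u(D) = 0\<close>, the coboundary of \<open>u\<close> at \<open>(D, e\<^sub>j)\<close> multiplies the
  \<open>e\<^sub>i\<close>-coordinate of \<open>u(e\<^sub>j)\<close> by \<open>w\<^sub>i - w\<^sub>j\<close>; so dividing \<open>\<phi>(D, -)\<close> by the weight differences
  removes every part of it that does not preserve weights.\<close>

lemma cga_cocycle2_graded_representative:
  assumes \<phi>: "cocycle2 (cga_hat (cga_L k)) \<phi>"
  obtains u where "linear_endo (cga_hat (cga_L k)) u"
    "cga_graded k (\<lambda>x y. \<phi> x y - coboundary1 (cga_hat (cga_L k)) u x y)"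
proof
  \<comment> \<open>Division by zero makes the weight-preserving coordinates of \<open>T\<close> vanish.\<close>
  define T where "T j i = \<phi> (cga_unit eD) (cga_unit j) i / of_int (cga_weight k i - cga_weight k j)" for i j
  let ?u = "cga_lin k T" and ?D = "cga_unit eD"
  have val: "\<phi> ?D (cga_unit j) \<in> cga_space k" if "j \<in> cga_basis_of k" for j
    using cga.linear_endo_simps(1)[OF cga.cocycle2_simps(1)[OF \<phi>], of ?D "cga_unit j"] that by simp
  then have T: "T j \<in> cga_space k" if "j \<in> cga_basis_of k" for j
    using that by (auto simp: T_def cga_space_def)
  show u: "linear_endo (cga_hat (cga_L k)) ?u" by (rule linear_endo_cga_lin[OF T])
  have TD: "T eD = 0"
    using cga.cocycle2_simps(3)[OF \<phi>, of ?D] by (simp add: T_def fun_eq_iff)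
  show "cga_graded k (\<lambda>x y. \<phi> x y - coboundary1 (cga_hat (cga_L k)) ?u x y)"
  proof (rule cga_graded_cocycle2[OF cga.cocycle2_diff[OF \<phi> cga.cocycle2_coboundary1[OF u]]])
    fix j assume j: "j \<in> cga_basis_of k"
    let ?d = "\<phi> ?D (cga_unit j) - coboundary1 (cga_hat (cga_L k)) ?u ?D (cga_unit j)"
    have B0: "cga_br k (cga_unit j) (T eD) = 0"
      using cga.bracket_simps(6)[of "cga_unit j" k] j unfolding TD by simp
    have "?d i = \<phi> ?D (cga_unit j) i - of_int (cga_weight k i - cga_weight k j) * T j i" for i
      using j T[OF j] by (simp add: coboundary1_def B0 cga_ad_D) (simp add: cga_scale_def algebra_simps)
    then have "?d i = 0" if "cga_weight k i \<noteq> cga_weight k j" for i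
      using that by (simp add: T_def)
    moreover have "?d \<in> cga_space k"
      using cga.L_closed(3)[of _ k] val[OF j]
        cga.linear_endo_simps(1)[OF cga.cocycle2_simps(1)[OF cga.cocycle2_coboundary1[OF u]], of ?D "cga_unit j"] j
      by simp
    ultimately show "?d \<in> cga_wspace k (cga_weight k j)" by (auto simp: cga_wspace_def)
  qed
qed

section \<open>Normalisation by weight-preserving endomorphisms\<close>

text \<open>The values that a weight-preserving endomorphism can remove. In the last condition, the
  \<open>D\<close> part of \<open>\<phi>(P\<^sub>0, P\<^sub>N)\<close> is left free.\<close>

definition cga_normalized :: "nat \<Rightarrow> ((cga_index \<Rightarrow> complex) \<Rightarrow> (cga_index \<Rightarrow> complex) \<Rightarrow> cga_index \<Rightarrow> complex) \<Rightarrow> bool" where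
  "cga_normalized k \<phi> \<longleftrightarrow> cga_graded k \<phi> \<and>
     \<phi> (cga_unit eD) (cga_unit eH) = 0 \<and> \<phi> (cga_unit eC) (cga_unit eH) = 0 \<and>
     \<phi> (cga_unit eH) (cga_unit eM) = 0 \<and>
     (\<forall>n\<le>2 * k + 1. \<phi> (cga_unit eH) (cga_unit (eP n)) = 0) \<and>
     \<phi> (cga_unit (eP 0)) (cga_unit (eP (2 * k + 1))) eM = 0"

text \<open>The endomorphism is diagonal except that \<open>D\<close> and \<open>M\<close>, both of weight 0, may be mixed. Its
  coefficients are found one after the other: that of \<open>D\<close> from \<open>\<phi>(D, H)\<close>, then the \<open>M\<close> part of
  the image of \<open>D\<close> and the coefficient of \<open>C\<close> from \<open>\<phi>(C, H)\<close>, that of \<open>P\<^sub>n\<close> recursively from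
  \<open>\<phi>(H, P\<^sub>n)\<close>, and the image of \<open>M\<close> from \<open>\<phi>(H, M)\<close> and \<open>\<phi>(P\<^sub>0, P\<^sub>N)\<close>. The coefficients
  of \<open>H\<close> and \<open>P\<^sub>0\<close> are set to 0, which fixes the freedom of adding a multiple of \<open>ad D\<close> or of the
  derivation with \<open>P\<^sub>n \<mapsto> P\<^sub>n\<close> and \<open>M \<mapsto> 2M\<close>.\<close>

lemma cga_graded_cocycle2_normal_form:
  assumes \<phi>: "cocycle2 (cga_hat (cga_L k)) \<phi>" and gr: "cga_graded k \<phi>"
  obtains u where "linear_endo (cga_hat (cga_L k)) u"
    "cga_normalized k (\<lambda>x y. \<phi> x y - coboundary1 (cga_hat (cga_L k)) u x y)"
proof
  define c where "c i j = \<phi> (cga_unit i) (cga_unit j)" for i j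
  define N where "N = 2 * k + 1"
  define a where "a = c eD eH eH / 2"
  define p where "p n = - (\<Sum>m=1..n. c eH (eP m) (eP (m - 1)) / of_nat m)" for n
  define T where "T j = (case j of
      eC \<Rightarrow> cga_scale (c eC eH eD + a) (cga_unit eC)
    | eD \<Rightarrow> cga_scale a (cga_unit eD) - cga_scale (c eC eH eM) (cga_unit eM)
    | eH \<Rightarrow> 0
    | eM \<Rightarrow> cga_scale (- c eH eM eH / 2) (cga_unit eD)
        + cga_scale (p 0 + p N - c (eP 0) (eP N) eM / cga_b (cga_L k) 0) (cga_unit eM)
    | eP n \<Rightarrow> cga_scale (p n) (cga_unit (eP n)))" for j
  let ?u = "cga_lin k T"
  have T: "T j \<in> cga_wspace k (cga_weight k j)" if "j \<in> cga_basis_of k" for j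
    using that
    by (cases j) (auto simp: T_def cga_wspace_def cga_space_def cga_scale_def cga_unit_def cga_basis_half)
  show u: "linear_endo (cga_hat (cga_L k)) ?u"
    using T by (intro linear_endo_cga_lin) (auto simp: cga_wspace_def)
  let ?\<psi> = "\<lambda>x y. \<phi> x y - coboundary1 (cga_hat (cga_L k)) ?u x y"
  have gr': "cga_graded k ?\<psi>"
    by (rule cga_graded_diff[OF gr cga_graded_coboundary1[OF T]])
  have Ts: "T eC \<in> cga_space k" "T eD \<in> cga_space k" "T eH \<in> cga_space k" "T eM \<in> cga_space k"
    "n \<le> 2 * k + 1 \<Longrightarrow> T (eP n) \<in> cga_space k" for n
    using T by (auto simp: cga_wspace_def)
  note coords = coboundary1_def cga_ad_D cga_ad_H cga_ad_C cga_ad_M cga_ad_P_M Ts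
  have e: "?\<psi> (cga_unit i) (cga_unit j) = 0"
    if "i \<in> cga_basis_of k" "j \<in> cga_basis_of k"
      "\<And>l. l \<in> cga_basis_of k \<Longrightarrow> cga_weight k l = cga_weight k i + cga_weight k j \<Longrightarrow>
        coboundary1 (cga_hat (cga_L k)) ?u (cga_unit i) (cga_unit j) l = c i j l" for i j
    by (rule cga_wspace_eq_0[OF cga_gradedD[OF gr' that(1,2)]]) (simp add: that(3) c_def)
  show "cga_normalized k ?\<psi>"
    unfolding cga_normalized_def
  proof (intro conjI allI impI gr')
    show "?\<psi> (cga_unit eD) (cga_unit eH) = 0"
    proof (rule e)
      fix l assume "l \<in> cga_basis_of k" "cga_weight k l = cga_weight k eD + cga_weight k eH"
      then have "l = eH" by (cases l) (auto, presburger)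
      then show "coboundary1 (cga_hat (cga_L k)) ?u (cga_unit eD) (cga_unit eH) l = c eD eH l"
        by (simp add: coords) (simp add: T_def a_def cga_scale_def cga_unit_def)
    qed simp_all
    show "?\<psi> (cga_unit eC) (cga_unit eH) = 0"
    proof (rule e)
      fix l assume "l \<in> cga_basis_of k" "cga_weight k l = cga_weight k eC + cga_weight k eH"
      then have "l = eD \<or> l = eM" by (cases l) (auto, presburger)
      then show "coboundary1 (cga_hat (cga_L k)) ?u (cga_unit eC) (cga_unit eH) l = c eC eH l"
        by (elim disjE) (simp_all add: coords, simp_all add: T_def a_def cga_scale_def cga_unit_def)
    qed simp_all
    show "?\<psi> (cga_unit eH) (cga_unit eM) = 0"
    proof (rule e)
      fix l assume "l \<in> cga_basis_of k" "cga_weight k l = cga_weight k eH + cga_weight k eM"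
      then have "l = eH" by (cases l) (auto, presburger)
      then show "coboundary1 (cga_hat (cga_L k)) ?u (cga_unit eH) (cga_unit eM) l = c eH eM l"
        by (simp add: coords) (simp add: T_def a_def cga_scale_def cga_unit_def cga_lin_def)
    qed simp_all
  next
    fix n assume n: "n \<le> 2 * k + 1"
    show "?\<psi> (cga_unit eH) (cga_unit (eP n)) = 0"
    proof (rule e)
      fix l assume "l \<in> cga_basis_of k" "cga_weight k l = cga_weight k eH + cga_weight k (eP n)"
      then have "l = eP (n - 1) \<and> n > 0" by (cases l) (auto, presburger+)
      moreover have "of_nat n * (p (n - 1) - p n) = c eH (eP n) (eP (n - 1))" if "n > 0"
        using that by (cases n) (simp_all add: p_def del: of_nat_Suc)
      moreover have "cga_br k (cga_unit (eP n)) (T eH) = 0"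
        by (simp add: T_def fun_eq_iff cga_bracket_apply)
      ultimately show "coboundary1 (cga_hat (cga_L k)) ?u (cga_unit eH) (cga_unit (eP n)) l = c eH (eP n) l"
        using n by (simp add: coords) (simp add: T_def cga_scale_def cga_unit_def algebra_simps)
    qed (use n in simp_all)
  next
    show "?\<psi> (cga_unit (eP 0)) (cga_unit (eP (2 * k + 1))) eM = 0"
      using cga_b_nonzero[of "cga_L k" 0] cga_b_last[of k]
      by (simp add: coords) (simp add: T_def c_def N_def cga_scale_def cga_unit_def field_simps)
  qed
qed

section \<open>Normalised cocycles vanish\<close>

text \<open>Each remaining value is a combination of at most two basis elements, and its coefficients obey
  recursions read off from single coordinates of the cocycle identity. A value \<open>\<phi>(P\<^sub>m, P\<^sub>n)\<close> can be
  nonzero only for \<open>m + n\<close> equal to \<open>N + 1\<close>, \<open>N\<close> or \<open>N - 1\<close>, where it lies in the span of \<open>C\<close>, of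
  \<open>D, M\<close> and of \<open>H\<close>, respectively. Invariance under \<open>H\<close> and skew symmetry kill the \<open>C\<close> part,
  then invariance under \<open>C\<close> the \<open>D\<close> part, then again invariance under \<open>H\<close> the \<open>H\<close> part.\<close>

lemma cga_normalized_cocycle2_unit:
  assumes \<phi>: "cocycle2 (cga_hat (cga_L k)) \<phi>" and nf: "cga_normalized k \<phi>"
    and ij: "i \<in> cga_basis_of k" "j \<in> cga_basis_of k"
  shows "\<phi> (cga_unit i) (cga_unit j) = 0"
proof -
  define F where "F i j = \<phi> (cga_unit i) (cga_unit j)" for i j
  define N where "N = 2 * k + 1"
  let ?I = "cga_basis_of k" and ?e = cga_unit
  have P [simp]: "eP n \<in> ?I \<longleftrightarrow> n \<le> N" for n by (simp add: N_def)
  have FW: "F i j \<in> cga_wspace k (cga_weight k i + cga_weight k j)" if "i \<in> ?I" "j \<in> ?I" for i j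
    using nf that by (auto simp: F_def cga_normalized_def dest: cga_gradedD)
  have val [simp]: "F i j \<in> cga_space k" if "i \<in> ?I" "j \<in> ?I" for i j
    using FW[OF that] by (simp add: cga_wspace_def)
  have F0: "F i j = 0" if "i \<in> ?I" "j \<in> ?I"
    "\<And>l. l \<in> ?I \<Longrightarrow> cga_weight k l = cga_weight k i + cga_weight k j \<Longrightarrow> F i j l = 0" for i j
    using cga_wspace_eq_0[OF FW] that by blast
  have skew: "F j i = - F i j" if "i \<in> ?I" "j \<in> ?I" for i j
    using cga.cocycle2_skew[OF \<phi>, of "?e i" "?e j"] that by (simp add: F_def)
  have skew_at: "F j i c = - F i j c" if "i \<in> ?I" "j \<in> ?I" for i j c
    using skew[OF that] by simp
  have skew0: "F j i = 0" if "F i j = 0" "i \<in> ?I" "j \<in> ?I" for i j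
    using skew[OF that(2,3)] that(1) by simp
  have alt: "F i i = 0" if "i \<in> ?I" for i
    using cga.cocycle2_simps(3)[OF \<phi>, of "?e i"] that by (simp add: F_def)
  note lin = cga.linear_endo_simps[OF cga.cocycle2_simps(2)[OF \<phi>], unfolded cga_hat_simps]
  have scale: "\<phi> (cga_scale a (?e i)) (?e j) c = a * F i j c" if "i \<in> ?I" "j \<in> ?I" for i j a c
    using lin(3) that by (simp add: F_def cga_scale_def)
  have zero: "\<phi> 0 (?e j) c = 0" "\<phi> (\<lambda>_. 0) (?e j) c = 0" if "j \<in> ?I" for j c
    using lin(6)[of "?e j"] that by (simp_all add: zero_fun_def)
  have coc: "cga_br k (?e i) (F j l) c + cga_br k (?e j) (F l i) c + cga_br k (?e l) (F i j) c
      = \<phi> (cga_br k (?e i) (?e j)) (?e l) c + \<phi> (cga_br k (?e j) (?e l)) (?e i) c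
        + \<phi> (cga_br k (?e l) (?e i)) (?e j) c" if "i \<in> ?I" "j \<in> ?I" "l \<in> ?I" for i j l c
    using fun_cong[OF cga.cocycle2_simps(4)[OF \<phi>, of "?e i" "?e j" "?e l"], of c] that
    by (simp add: F_def)
  have br0: "cga_br k x 0 c = 0" "cga_br k x (\<lambda>_. 0) c = 0" for x c
    by (simp_all add: cga_bracket_apply)
  have DH: "F eD eH = 0" "F eH eD = 0" and CH: "F eC eH = 0" "F eH eC = 0"
    and HM: "F eH eM = 0" "F eM eH = 0"
    and HP: "\<And>n. n \<le> N \<Longrightarrow> F eH (eP n) = 0" "\<And>n. n \<le> N \<Longrightarrow> F (eP n) eH = 0"
    and PP0: "F (eP 0) (eP N) eM = 0"
    using nf skew0[of eD eH] skew0[of eC eH] skew0[of eH eM] skew0[of eH "eP _"]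
    by (auto simp: cga_normalized_def F_def N_def)
  have unit: "\<phi> (?e i) (?e j) = F i j" for i j by (simp add: F_def)
  note ze = DH CH HM HP br0 zero scale unit

  have CD: "F eC eD = 0"
  proof (rule F0)
    fix l assume "l \<in> ?I" "cga_weight k l = cga_weight k eC + cga_weight k eD"
    then have "l = eC" by (cases l) (auto, presburger)
    moreover have "F eC eD eC = 0"
      using coc[of eC eD eH eD] by (simp add: ze alt cga_ad_H)
    ultimately show "F eC eD l = 0" by simp
  qed simp_all
  note ze = ze CD skew0[OF CD, simplified]

  \<comment> \<open>The triple \<open>D, H, P\<^sub>n\<close> makes \<open>q\<close> constant, and \<open>C, H, P\<^sub>n\<close> then gives \<open>s\<^sub>n = q\<^sub>0\<close> for
    \<open>n < N\<close>. At \<open>n = N\<close> there is no \<open>P\<^sub>N\<^sub>+\<^sub>1\<close>, and \<open>0 = q\<^sub>0 + N q\<^sub>0\<close> results.\<close>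
  define q where "q n = F eD (eP n) (eP n)" for n
  define s where "s n = F eC (eP n) (eP (n + 1))" for n
  have q: "q n = q (n - 1)" if "n \<le> N" for n
  proof (cases n)
    case (Suc m)
    have "of_nat (Suc m) * q (Suc m) = of_nat (Suc m) * q m"
      using coc[of eD eH "eP n" "eP m"] that skew_at[of eD "eP (Suc m)"] skew_at[of eD "eP m"] unfolding Suc
      by (simp add: ze cga_ad_H q_def N_def algebra_simps)
    then show ?thesis unfolding Suc by (simp del: of_nat_Suc)
  qed simp
  have s: "of_nat (n + 1) * s n = q n + of_nat n * s (n - 1)" if "n \<le> N" for n
  proof (cases n)
    case 0
    then show ?thesis
      using coc[of eC eH "eP 0" "eP 0"] skew_at[of eC "eP 0"]
      by (simp add: ze cga_ad_H q_def s_def N_def algebra_simps)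
  next
    case (Suc m)
    show ?thesis
    proof (cases "n = N")
      case True
      then show ?thesis
        using coc[of eC eH "eP n" "eP n"] skew_at[of eC "eP n"] skew_at[of eC "eP m"] unfolding Suc
        by (simp add: ze cga_ad_H q_def s_def N_def algebra_simps)
    next
      case False
      then show ?thesis
        using that coc[of eC eH "eP n" "eP n"] skew_at[of eC "eP n"] skew_at[of eC "eP m"] unfolding Suc
        by (simp add: ze cga_ad_H q_def s_def N_def algebra_simps)
    qed
  qed
  have q_const: "q n = q 0" if "n \<le> N" for n
    using that
  proof (induction n)
    case (Suc n)
    then show ?case using q[of "Suc n"] by simp
  qed simp
  have s_const: "s n = q 0" if "n < N" for n
    using that
  proof (induction n)
    case 0
    then show ?case using s[of 0] by simp
  next
    case (Suc n)
    then have "of_nat (Suc (Suc n)) * s (Suc n) = of_nat (Suc (Suc n)) * q 0"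
      using s[of "Suc n"] q_const[of "Suc n"] by (simp add: algebra_simps)
    then show ?case by (simp del: of_nat_Suc)
  qed
  have "s N = 0"
    using cga_space_outside[OF val, of eC "eP N" "eP (N + 1)"] by (simp add: s_def N_def)
  then have "of_nat (Suc N) * q 0 = 0"
    using s[of N] q_const[of N] s_const[of "N - 1"] by (simp add: N_def algebra_simps)
  then have q0: "q 0 = 0" by (simp del: of_nat_Suc)
  have DP: "F eD (eP n) = 0" if "n \<le> N" for n
  proof (rule F0)
    fix l assume "l \<in> ?I" "cga_weight k l = cga_weight k eD + cga_weight k (eP n)"
    then have "l = eP n" by (cases l) (auto, presburger+)
    then show "F eD (eP n) l = 0" using q_const[OF that] q0 by (simp add: q_def)
  qed (use that in \<open>simp_all add: N_def\<close>)
  have CP: "F eC (eP n) = 0" if "n \<le> N" for n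
  proof (rule F0)
    fix l assume l: "l \<in> ?I" "cga_weight k l = cga_weight k eC + cga_weight k (eP n)"
    then have "l = eP (n + 1)" by (cases l) (auto, presburger+)
    then show "F eC (eP n) l = 0" using l s_const[of n] q0 by (simp add: s_def N_def)
  qed (use that in \<open>simp_all add: N_def\<close>)
  note ze = ze DP skew0[OF DP, simplified] CP skew0[OF CP, simplified]

  have DM_D: "F eD eM eD = 0"
    using coc[of eH eD eM eH] by (simp add: ze cga_ad_H)
  have CM: "F eC eM = 0"
  proof (rule F0)
    fix l assume "l \<in> ?I" "cga_weight k l = cga_weight k eC + cga_weight k eM"
    then have "l = eC" by (cases l) (auto, presburger)
    moreover have "F eC eM eC = 0"
      using coc[of eC eH eM eD] skew_at[of eC eM] DM_D by (simp add: ze cga_ad_H)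
    ultimately show "F eC eM l = 0" by simp
  qed simp_all
  note ze = ze CM skew0[OF CM, simplified]
  have DM: "F eD eM = 0"
  proof
    show "F eD eM l = 0 l" for l using coc[of eC eH eM l] by (simp add: ze)
  qed
  note ze = ze DM skew0[OF DM, simplified]

  \<comment> \<open>The map \<open>(P\<^sub>n, M) \<mapsto> t P\<^sub>n\<close> is \<open>sl\<^sub>2\<close>-invariant for constant \<open>t\<close>; the triple \<open>P\<^sub>0, P\<^sub>N, M\<close>
    excludes it.\<close>
  define t where "t n = F (eP n) eM (eP n)" for n
  have t: "t n = t (n - 1)" if "n \<le> N" for n
  proof (cases n)
    case (Suc m)
    have "of_nat (Suc m) * t (Suc m) = of_nat (Suc m) * t m"
      using coc[of eH "eP n" eM "eP m"] that unfolding Suc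
      by (simp add: ze cga_ad_H t_def N_def algebra_simps)
    then show ?thesis unfolding Suc by (simp del: of_nat_Suc)
  qed simp
  have t_const: "t n = t 0" if "n \<le> N" for n
    using that
  proof (induction n)
    case (Suc n)
    then show ?case using t[of "Suc n"] by simp
  qed simp
  have "cga_b (cga_L k) 0 * (t N + t 0) = 0"
    using coc[of "eP 0" "eP N" eM eM] skew_at[of "eP 0" eM] cga_b_last[of k]
    by (simp add: ze alt cga_ad_P_M cga_ad_M t_def N_def algebra_simps)
  then have t0: "t 0 = 0" using t_const[of N] cga_b_nonzero[of "cga_L k" 0] by simp
  have PM: "F (eP n) eM = 0" if "n \<le> N" for n
  proof (rule F0)
    fix l assume "l \<in> ?I" "cga_weight k l = cga_weight k (eP n) + cga_weight k eM"
    then have "l = eP n" by (cases l) (auto, presburger+)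
    then show "F (eP n) eM l = 0" using t_const[OF that] t0 by (simp add: t_def)
  qed (use that in \<open>simp_all add: N_def\<close>)
  note ze = ze PM skew0[OF PM, simplified]

  have Hinv: "cga_br k (?e eH) (F (eP m) (eP n)) c
      = - of_nat m * F (eP (m - 1)) (eP n) c - of_nat n * F (eP m) (eP (n - 1)) c"
    if "m \<le> N" "n \<le> N" for m n c
    using coc[of eH "eP m" "eP n" c] skew_at[of "eP m" "eP (n - 1)" c] that
    by (simp add: ze N_def)
  \<comment> \<open>For \<open>m + n = N + 1\<close> the middle value is \<open>\<phi>(P\<^sub>k\<^sub>+\<^sub>1, P\<^sub>k\<^sub>+\<^sub>1) = 0\<close>, as \<open>N + 1 = 2(k + 1)\<close>; the
    recursion spreads this zero to the end of the chain, and skew symmetry reflects it.\<close>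
  have y_up: "F (eP (k + 1 + j)) (eP (k + 1 - j)) = 0" if "j \<le> k" for j
    using that
  proof (induction j)
    case 0
    then show ?case by (simp add: alt N_def)
  next
    case (Suc j)
    define a b where "a = k + 2 + j" and "b = k + 1 - j"
    have ab: "a - 1 = k + 1 + j" "a = k + 1 + Suc j" "b - 1 = k + 1 - Suc j" "a \<le> N" "b \<le> N" "b \<noteq> 0"
      "a + b = N + 2"
      using Suc.prems by (auto simp: a_def b_def N_def)
    have "F (eP a) (eP b) = 0"
    proof (rule F0)
      fix l assume "l \<in> ?I" "cga_weight k l = cga_weight k (eP a) + cga_weight k (eP b)"
      then show "F (eP a) (eP b) l = 0"
        using ab(7) by (cases l) (auto simp: N_def, presburger+)
    qed (use ab in \<open>simp_all add: N_def\<close>)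
    moreover have "F (eP (a - 1)) (eP b) = 0"
      unfolding ab(1) b_def by (rule Suc.IH) (use Suc.prems in simp)
    ultimately have "of_nat b * F (eP a) (eP (b - 1)) c = 0" for c
      using Hinv[OF ab(4,5), of c] by (simp add: ze)
    then have "F (eP a) (eP (b - 1)) = 0"
      using ab(6) by (simp add: fun_eq_iff)
    then show ?case using ab(2,3) by simp
  qed
  have y: "F (eP m) (eP n) = 0" if "m + n = N + 1" "m \<le> N" "n \<le> N" for m n
  proof -
    have up: "F (eP m) (eP n) = 0" if mn: "m + n = N + 1" "m \<ge> k + 1" "m \<le> N" for m n
    proof -
      obtain j where m: "m = k + 1 + j" using mn(2) le_Suc_ex by blast
      then have "n = k + 1 - j" "j \<le> k" using mn by (auto simp: N_def)
      then show ?thesis unfolding m by (simp only: y_up)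
    qed
    show ?thesis
      using up[of m n] skew0[OF up[of n m]] that by (cases "m \<ge> k + 1") (auto simp: N_def)
  qed
  \<comment> \<open>The \<open>M\<close> parts are proportional to \<open>\<omega>\<close>, hence determined by the normalised one at \<open>(P\<^sub>0, P\<^sub>N)\<close>.\<close>
  have v: "F (eP m) (eP (N - m)) eM = 0" if "m \<le> N" for m
    using that
  proof (induction m)
    case 0
    then show ?case using PP0 by simp
  next
    case (Suc m)
    then have "of_nat (N - m) * F (eP (Suc m)) (eP (N - Suc m)) eM = 0"
      using Hinv[of "Suc m" "N - m" eM] by (simp add: cga_ad_H N_def del: of_nat_diff)
    then show ?case using Suc.prems by (simp del: of_nat_diff)
  qed
  \<comment> \<open>As \<open>[C, D] = 2C\<close>, invariance under \<open>C\<close> expresses the \<open>D\<close> part by values with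
    \<open>m + n = N + 1\<close>.\<close>
  have u: "F (eP m) (eP n) eD = 0" if "m + n = N" for m n
  proof -
    have br: "\<phi> (cga_br k (?e eC) (?e (eP m))) (?e (eP n)) c = 0" if mn: "m + n = N" for m n c
    proof (cases "n = 0")
      case True
      then show ?thesis using mn by (simp add: N_def ze)
    next
      case False
      then show ?thesis using mn y[of "Suc m" n] by (simp add: ze N_def)
    qed
    have "cga_br k (?e (eP n)) (?e eC) = - cga_br k (?e eC) (?e (eP n))"
      using cga.bracket_skew[of "?e eC" k "?e (eP n)"] that by (simp add: N_def)
    then have "\<phi> (cga_br k (?e (eP n)) (?e eC)) (?e (eP m)) eC = 0"
      using br[of n m eC] that lin(4)[of "?e (eP m)" "cga_br k (?e eC) (?e (eP n))"]
      by (simp add: cga_bracket_in N_def)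
    then show ?thesis
      using coc[of eC "eP m" "eP n" eC] br[of m n eC] that
      by (simp add: ze cga_ad_C N_def)
  qed
  have uv: "F (eP m) (eP n) = 0" if "m + n = N" for m n
  proof (rule F0)
    fix l assume "l \<in> ?I" "cga_weight k l = cga_weight k (eP m) + cga_weight k (eP n)"
    then have "l = eD \<or> l = eM" using that by (cases l) (auto simp: N_def, presburger+)
    then show "F (eP m) (eP n) l = 0" using u[OF that] v[of m] that by auto
  qed (use that in \<open>simp_all add: N_def\<close>)
  \<comment> \<open>At \<open>m = 0\<close> one of the two terms of the recursion is missing, which gives the initial zero.\<close>
  have x: "F (eP m) (eP (N - 1 - m)) = 0" if "m < N" for m
    using that
  proof (induction m)
    case 0
    have "of_nat N * F (eP 0) (eP (N - 1)) c = 0" for c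
      using Hinv[of 0 N c] uv[of 0 N] by (simp add: ze)
    then show ?case using 0 by (simp add: fun_eq_iff)
  next
    case (Suc m)
    have "of_nat (N - Suc m) * F (eP (Suc m)) (eP (N - Suc m - 1)) c = 0" for c
      using Hinv[of "Suc m" "N - Suc m" c] uv[of "Suc m" "N - Suc m"] Suc by (simp add: ze del: of_nat_diff)
    then show ?case using Suc.prems by (simp add: fun_eq_iff del: of_nat_diff)
  qed
  have PP: "F (eP m) (eP n) = 0" if mn: "m \<le> N" "n \<le> N" for m n
  proof -
    consider "m + n = N + 1" | "m + n = N" | "m + n + 1 = N" | "m + n \<notin> {N - 1, N, N + 1}"
      by fastforce
    then show ?thesis
    proof cases
      case 3
      then have "n = N - 1 - m" "m < N" by auto
      then show ?thesis using x by simp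
    next
      case 4
      show ?thesis
      proof (rule F0)
        fix l assume "l \<in> ?I" "cga_weight k l = cga_weight k (eP m) + cga_weight k (eP n)"
        then show "F (eP m) (eP n) l = 0"
          using 4 by (cases l) (auto simp: N_def, presburger+)
      qed (use mn in \<open>simp_all add: N_def\<close>)
    qed (use y uv mn in auto)
  qed
  note ze = ze PP
  show ?thesis
    using ij unfolding unit by (cases i; cases j; simp add: ze alt N_def)
qed

theorem theorem5p2:
  fixes l :: real
  assumes "\<exists>k::nat. l = 1 / 2 + real k"
  shows "CE_cohomology (cga_hat l) (adjoint_module (cga_hat l)) 2
    = {CE_coboundaries (cga_hat l) (adjoint_module (cga_hat l)) 2}"
proof -
  obtain k where l: "l = cga_L k" using assms unfolding cga_L_def by blast
  let ?g = "cga_hat (cga_L k)"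
  have "\<exists>u. linear_endo ?g u \<and> (\<forall>x\<in>lspace ?g. \<forall>y\<in>lspace ?g. \<phi> x y = coboundary1 ?g u x y)"
    if \<phi>: "cocycle2 ?g \<phi>" for \<phi>
  proof -
    obtain u where u: "linear_endo ?g u" "cga_graded k (\<lambda>x y. \<phi> x y - coboundary1 ?g u x y)"
      by (rule cga_cocycle2_graded_representative[OF \<phi>])
    have 1: "cocycle2 ?g (\<lambda>x y. \<phi> x y - coboundary1 ?g u x y)"
      by (rule cga.cocycle2_diff[OF \<phi> cga.cocycle2_coboundary1[OF u(1)]])
    obtain v where v: "linear_endo ?g v"
      "cga_normalized k (\<lambda>x y. \<phi> x y - coboundary1 ?g u x y - coboundary1 ?g v x y)"
      by (rule cga_graded_cocycle2_normal_form[OF 1 u(2)])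
    have 2: "cocycle2 ?g (\<lambda>x y. \<phi> x y - coboundary1 ?g u x y - coboundary1 ?g v x y)"
      by (rule cga.cocycle2_diff[OF 1 cga.cocycle2_coboundary1[OF v(1)]])
    have zero: "\<phi> x y - coboundary1 ?g u x y - coboundary1 ?g v x y = 0"
      if "x \<in> lspace ?g" "y \<in> lspace ?g" for x y
      by (rule cga_cocycle2_expand[OF 2 _ _ cga_normalized_cocycle2_unit[OF 2 v(2)]]) (use that in simp_all)
    have sum: "coboundary1 ?g (\<lambda>x. u x + v x) x y = coboundary1 ?g u x y + coboundary1 ?g v x y"
      if "x \<in> lspace ?g" "y \<in> lspace ?g" for x y
      using that cga.linear_endo_simps(1)[OF u(1)] cga.linear_endo_simps(1)[OF v(1)]
      unfolding coboundary1_def by (simp add: cga.bracket_simps(2)[simplified] fun_eq_iff algebra_simps)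
    show ?thesis
    proof (intro exI conjI ballI)
      show "linear_endo ?g (\<lambda>x. u x + v x)" by (rule cga.linear_endo_add[OF u(1) v(1)])
      fix x y assume "x \<in> lspace ?g" "y \<in> lspace ?g"
      then show "\<phi> x y = coboundary1 ?g (\<lambda>x. u x + v x) x y"
        using zero[of x y] sum[of x y] by (simp only: diff_diff_eq right_minus_eq)
    qed
  qed
  then show ?thesis unfolding l by (rule cga.CE_cohomology_2_vanishes)
qed

end
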